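(* Fix an integer $k\ge1$, a symmetric matrix $A\in\mathbb{R}^{k\times k}$ and $\beta>0$. For an integer $n>k$ and $\beta'\ge 0$ let $$Z_n(\beta')=\int_{x_1\in\mathbb{R}^n}dx_1\cdots\int_{x_k\in\mathbb{R}^n}dx_k\ \exp\Big(\beta' n\sum_{i,j=1}^k\langle x_i,x_j\rangle A_{ij}\Big)\prod_{i=1}^k\delta(1-\lVert x_i\rVert^2),$$ and define the normalized free energy $Q_n(\beta)=\ln\left(\frac{Z_n(\beta)}{Z_n(0)}\right)$. Let $q^{\star}_{\beta}$ be the maximal value of $$\max_{S\in\mathbb{R}^{k\times k}}\ \beta\,\mathrm{tr}(AS)+\tfrac12\log\det(S)\quad\text{subject to } S\succeq 0,\ S_{ii}=1,\ i=1,\dots,k.$$ Then $$Q_n(\beta)=n\,q^{\star}_{\beta}+O(1),$$ where the $O(1)$ term is bounded by a constant that is independent of $n$ and depends only on $A$ and $\beta$.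
   Context: Here $\int_{\mathbb{R}^n}\varphi(x)\,\delta(1-\lVert x\rVert^2)\,dx$ denotes integration against a (fixed constant multiple of) surface measure on the unit sphere $\mathbb{S}^{n-1}\subset\mathbb{R}^n$; the constant cancels in the ratio $Z_n(\beta)/Z_n(0)$. $\log\det(S)=-\infty$ for singular $S\succeq0$. The matrix variable $S$ ranges over symmetric matrices. *)

theory Defs
  imports "HOL-Analysis.Analysis"
begin

text \<open>
  Since the bound to be stated is uniform in the dimension n, points of n-space are extensional
  functions on \<open>{..<n}\<close>. The size k of the matrices is fixed, and is the
  cardinality of an index type.
\<close>

abbreviation lebesgue_n :: "nat \<Rightarrow> (nat \<Rightarrow> real) measure" where
  "lebesgue_n n \<equiv> \<Pi>\<^sub>M i\<in>{..<n}. lborel"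

definition inner_n :: "nat \<Rightarrow> (nat \<Rightarrow> real) \<Rightarrow> (nat \<Rightarrow> real) \<Rightarrow> real" where
  "inner_n n x y = (\<Sum>i<n. x i * y i)"

definition norm_n :: "nat \<Rightarrow> (nat \<Rightarrow> real) \<Rightarrow> real" where
  "norm_n n x = sqrt (inner_n n x x)"

definition normalize_n :: "nat \<Rightarrow> (nat \<Rightarrow> real) \<Rightarrow> (nat \<Rightarrow> real)" where
  "normalize_n n x = (\<lambda>i\<in>{..<n}. x i / norm_n n x)"

text \<open>
  Surface measure on the unit sphere, through polar coordinates: the surface measure of B is n times
  the Lebesgue measure of the part \<open>{x. 0 < norm x \<le> 1 \<and> x / norm x \<in> B}\<close> of the unit ball.
  It is realised as a measure on all of n-space, concentrated on the sphere.
\<close>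

definition sphere_measure :: "nat \<Rightarrow> (nat \<Rightarrow> real) measure" where
  "sphere_measure n =
     scale_measure (of_nat n)
       (distr (restrict_space (lebesgue_n n) {x. 0 < norm_n n x \<and> norm_n n x \<le> 1})
              (lebesgue_n n) (normalize_n n))"

text \<open>
  The measure \<open>\<delta>(1 - norm x ^ 2) dx\<close>. The factor 1/2 is the radial integral of
  \<open>\<delta>(1 - r ^ 2) * r ^ (n - 1)\<close> over \<open>r > 0\<close>.
\<close>

definition sphere_delta :: "nat \<Rightarrow> (nat \<Rightarrow> real) measure" where
  "sphere_delta n = scale_measure (ennreal (1 / 2)) (sphere_measure n)"

definition partition_fun :: "nat \<Rightarrow> real \<Rightarrow> real^'k^'k \<Rightarrow> real" where
  "partition_fun n \<beta> A =
     (\<integral>x. exp (\<beta> * real n * (\<Sum>i\<in>UNIV. \<Sum>j\<in>UNIV. inner_n n (x i) (x j) * A $ i $ j))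
        \<partial>(\<Pi>\<^sub>M i\<in>(UNIV :: 'k set). sphere_delta n))"

definition free_energy :: "nat \<Rightarrow> real \<Rightarrow> real^'k^'k \<Rightarrow> real" where
  "free_energy n \<beta> A = ln (partition_fun n \<beta> A / partition_fun n 0 A)"

definition psd :: "real^'k^'k \<Rightarrow> bool" where
  "psd S \<longleftrightarrow> transpose S = S \<and> (\<forall>v. 0 \<le> v \<bullet> (S *v v))"

definition feasible :: "(real^'k^'k) set" where
  "feasible = {S. psd S \<and> (\<forall>i. S $ i $ i = 1)}"

text \<open>Only used for positive semidefinite matrices, whose determinant is nonnegative.\<close>

definition log_det :: "real^'k^'k \<Rightarrow> ereal" where
  "log_det S = (if det S > 0 then ereal (ln (det S)) else -\<infinity>)"

definition objective :: "real \<Rightarrow> real^'k^'k \<Rightarrow> real^'k^'k \<Rightarrow> ereal" where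
  "objective \<beta> A S = ereal (\<beta> * trace (A ** S)) + ereal (1 / 2) * log_det S"

definition q_star :: "real \<Rightarrow> real^'k^'k \<Rightarrow> ereal" where
  "q_star \<beta> A = (SUP S\<in>feasible. objective \<beta> A S)"

end

theory Submission
  imports Defs "HOL-Probability.Distributions"
begin

text \<open>
  Let \<open>S\<close> maximise the objective and put \<open>P = S\<^sup>-\<^sup>1\<close>. Stationarity says that
  \<open>P + 2\<beta>A\<close> is diagonal, so on the spheres the integrand is, up to an explicit factor, the Gaussian weight
  \<open>exp (- n/2 tr(P G))\<close> of the Gram matrix \<open>G\<close>. Integrated over all of space this weight
  is computed exactly by a linear change of variables. In polar coordinates the same integral is an
  average over radii \<open>r\<close>, and the radii with \<open>r\<^sub>i = 1 + O(1/sqrt n)\<close> suffice to compare it, up to a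
  constant factor, with the integral over the unit spheres: the first-order term in \<open>r - 1\<close> has a favourable
  sign on one orthant, which gives one inequality, and it is bounded where \<open>G - S = O(1/sqrt n)\<close>, an
  event of Gaussian probability at least 1/2 by Chebyshev, which gives the other. The case \<open>\<beta> = 0\<close>
  is the same estimate for the identity matrix, so all normalising constants and powers of \<open>n\<close> cancel.
\<close>

subsection \<open>Maximiser and stationarity\<close>

text \<open>Only bounded factors matter, so no density of the Gram matrix and no Laplace expansion
  is required: a window of radii on which the integrand changes by a bounded factor suffices, and
  the quadratic remainder, of size n (r - 1)^2, dictates its width. The two inequalities differ in
  nature. Bounding the sphere integral from above takes a lower bound of the radial integral for
  every tuple of unit vectors; for G far from S the first-order coefficient can have order n, so the
  window is put on the side where it helps. The converse takes an upper bound of the radial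
  integral, which may be exponentially large away from S, so the Gaussian integral is first cut down
  to Gram matrices near S; there PS = 1 reduces the coefficient to O(sqrt n). The entropy term is a
  Jacobian: with S = L L^T the change of variables contributes |det L|^n = det(S)^(n/2). The
  diagonal matrix P + 2\<beta>A multiplies the integrand by a constant on unit spheres and accounts
  for the trace term.\<close>

text \<open>The form attains its minimum 0 at \<open>v\<close>, so a small move against the gradient
  direction \<open>S *v v\<close> cannot lower it further.\<close>

lemma psd_quadratic_eq_0:
  fixes S :: "real^'k^'k"
  assumes "psd S" and "v \<bullet> (S *v v) = 0"
  shows "S *v v = 0"
proof (rule ccontr)
  define w where "w = S *v v"
  assume "S *v v \<noteq> 0"
  then have a: "w \<bullet> w > 0" by (simp add: w_def)
  have b: "w \<bullet> (S *v w) \<ge> 0" using assms(1) by (simp add: psd_def)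
  \<comment> \<open>The \<open>+ 1\<close> keeps the denominator positive; with this
    \<open>t\<close> the quadratic term is at most half the linear one.\<close>
  define t where "t = (w \<bullet> w) / (w \<bullet> (S *v w) + 1)"
  have sym: "v \<bullet> (S *v w) = w \<bullet> w"
    using assms(1) by (metis dot_lmul_matrix inner_commute psd_def transpose_matrix_vector w_def)
  have "0 \<le> (v - t *\<^sub>R w) \<bullet> (S *v (v - t *\<^sub>R w))"
    using assms(1) by (simp add: psd_def)
  also have "\<dots> = t * (t * (w \<bullet> (S *v w)) - 2 * (w \<bullet> w))"
    using assms(2) sym
    by (simp add: matrix_vector_mult_diff_distrib matrix_vector_mult_scaleR inner_diff_left
        inner_diff_right algebra_simps w_def[symmetric])
  finally have "0 \<le> t * (t * (w \<bullet> (S *v w)) - 2 * (w \<bullet> w))" .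
  moreover have "t > 0" using a b by (simp add: t_def)
  moreover have "t * (w \<bullet> (S *v w)) \<le> w \<bullet> w"
    using a b by (simp add: t_def field_simps)
  ultimately show False using a by (simp add: zero_le_mult_iff)
qed

lemma psd_det_pos_quadratic_pos:
  fixes S :: "real^'k^'k"
  assumes "psd S" "det S > 0" "v \<noteq> 0"
  shows "0 < v \<bullet> (S *v v)"
proof -
  have "S *v v \<noteq> 0"
    using assms(2,3) by (metis invertible_det_nz less_irrefl matrix_left_invertible_ker invertible_def)
  then show ?thesis
    using psd_quadratic_eq_0[OF assms(1)] assms(1) unfolding psd_def
    by (metis order_less_le)
qed

text \<open>Compactness of the unit sphere makes the positivity uniform. The constant
  \<open>m\<close> later tells how far \<open>S\<close> can be perturbed without leaving the
  semidefinite cone.\<close>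

lemma psd_det_pos_coercive:
  fixes S :: "real^'k^'k"
  assumes "psd S" "det S > 0"
  obtains m where "m > 0" "\<And>v. m * (v \<bullet> v) \<le> v \<bullet> (S *v v)"
proof -
  have c: "continuous_on (sphere 0 1) (\<lambda>v::real^'k. v \<bullet> (S *v v))"
    by (intro continuous_intros matrix_vector_mult_linear_continuous_on)
  obtain u :: "real^'k" where u: "u \<in> sphere 0 1" "\<And>v. v \<in> sphere 0 1 \<Longrightarrow> u \<bullet> (S *v u) \<le> v \<bullet> (S *v v)"
    using continuous_attains_inf[OF compact_sphere _ c] by (metis sphere_eq_empty not_one_less_zero ex_in_conv)
  have pos: "u \<bullet> (S *v u) > 0"
    using u(1) by (intro psd_det_pos_quadratic_pos[OF assms]) auto
  have "(u \<bullet> (S *v u)) * (v \<bullet> v) \<le> v \<bullet> (S *v v)" for v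
  proof (cases "v = 0")
    case False
    define w where "w = v /\<^sub>R norm v"
    have w: "w \<in> sphere 0 1" using False by (simp add: w_def)
    have vw: "v = norm v *\<^sub>R w" using False by (simp add: w_def)
    have "v \<bullet> (S *v v) = (norm v)^2 * (w \<bullet> (S *v w))"
      by (subst (1 2) vw) (simp add: matrix_vector_mult_scaleR power2_eq_square)
    then show ?thesis
      using u(2)[OF w] by (simp add: dot_square_norm mult_right_mono mult.commute[of "(norm v)\<^sup>2"])
  qed simp
  with pos show ?thesis using that by blast
qed

text \<open>A permutation other than the identity moves some \<open>a\<close> and also
  \<open>p a\<close>; differentiating one factor of its product leaves an off-diagonal entry of the
  identity matrix, so only the identity permutation contributes.\<close>

lemma has_real_derivative_det_mat_1:
  fixes M :: "real^'k^'k"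
  shows "((\<lambda>t. det (mat 1 + t *\<^sub>R M)) has_real_derivative trace M) (at 0)"
proof -
  let ?P = "{p. p permutes (UNIV :: 'k set)}"
  let ?f = "\<lambda>p t. of_int (sign p) * (\<Prod>i\<in>UNIV. (mat 1 + t *\<^sub>R M) $ i $ p i)"
  let ?d = "\<lambda>p. of_int (sign p) * (\<Sum>i\<in>UNIV. M $ i $ p i * (\<Prod>j\<in>UNIV - {i}. mat 1 $ j $ p j)) :: real"
  have "((\<lambda>t. \<Prod>i\<in>UNIV. (mat 1 + t *\<^sub>R M) $ i $ p i) has_real_derivative
      (\<Sum>i\<in>UNIV. M $ i $ p i * (\<Prod>j\<in>UNIV - {i}. (mat 1 + 0 *\<^sub>R M) $ j $ p j))) (at 0)" for p :: "'k \<Rightarrow> 'k"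
    by (rule has_field_derivative_prod) (auto intro!: derivative_eq_intros)
  then have d: "(?f p has_real_derivative ?d p) (at 0)" for p
    by (intro DERIV_cmult) simp
  have D: "((\<lambda>t. \<Sum>p\<in>?P. ?f p t) has_real_derivative (\<Sum>p\<in>?P. ?d p)) (at 0)"
    by (rule DERIV_sum[OF d])
  have z: "?d p = 0" if p: "p \<in> ?P" "p \<noteq> id" for p
  proof -
    obtain a where a: "p a \<noteq> a" using p(2) by (metis eq_id_iff)
    have pa: "p (p a) \<noteq> p a" using a p(1) by (metis mem_Collect_eq permutes_inverses(2))
    have "\<exists>j\<in>UNIV - {i}. mat 1 $ j $ p j = (0::real)" for i
    proof (cases "i = a")
      case True then show ?thesis using a pa by (intro bexI[of _ "p a"]) (auto simp: mat_def)
    next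
      case False then show ?thesis using a by (intro bexI[of _ a]) (auto simp: mat_def)
    qed
    then have "(\<Prod>j\<in>UNIV - {i}. mat 1 $ j $ p j) = (0::real)" for i
      by (meson finite prod_zero)
    then show ?thesis by (simp only: mult_zero_right sum.neutral_const)
  qed
  have "(\<Sum>p\<in>?P. ?d p) = (\<Sum>p\<in>{id}. ?d p)"
    by (rule sum.mono_neutral_right) (use z in \<open>auto simp: permutes_id\<close>)
  also have "\<dots> = trace M" by (simp add: sign_id trace_def mat_def)
  finally show ?thesis using D by (simp add: det_def)
qed

text \<open>The objective takes the value -\<infinity> on singular matrices, so its finite part
  \<open>h\<close> is maximised over the compact set of feasible matrices with determinant at least
  \<open>c\<close>, and everything outside is beaten by the identity matrix.\<close>

lemma exists_det_pos_maximizer: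
  fixes A :: "real^'k^'k"
  obtains S where "S \<in> feasible" "det S > 0" "\<And>T. T \<in> feasible \<Longrightarrow> objective \<beta> A T \<le> objective \<beta> A S"
proof -
  define h where "h S = \<beta> * trace (A ** S) + ln (det S) / 2" for S :: "real^'k^'k"
  have entry: "\<bar>S $ i $ j\<bar> \<le> 1" if S: "S \<in> feasible" for S :: "real^'k^'k" and i j
  proof -
    have q: "0 \<le> v \<bullet> (S *v v)" for v using S by (simp add: feasible_def psd_def)
    have d: "S $ i $ i = 1" for i using S by (simp add: feasible_def)
    have s: "S $ i $ j = S $ j $ i" for i j
      using S by (metis (mono_tags, lifting) feasible_def mem_Collect_eq psd_def transpose_def vec_lambda_beta)
    have e: "axis a c \<bullet> (S *v axis b d) = c * d * S $ a $ b" for a b and c d :: real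
      by (simp add: inner_axis' matrix_vector_mult_def) (simp add: axis_def if_distrib mult.commute cong: if_cong)
    show ?thesis
    proof (cases "i = j")
      case False
      \<comment> \<open>The form is tested on the sum and the difference of two unit vectors; the
        diagonal entries supply the 2.\<close>
      have "0 \<le> 2 + 2 * c * S $ i $ j" if "c = 1 \<or> c = -1" for c
        using q[of "axis i 1 + axis j c"] that
        by (auto simp: matrix_vector_right_distrib inner_add_left inner_add_right e d s[of j i])
      from this[of 1] this[of "-1"] show ?thesis by auto
    qed (simp add: d)
  qed
  have cl: "closed (feasible :: (real^'k^'k) set)"
  proof -
    have eq: "feasible = (\<Inter>i j. {S::real^'k^'k. S $ i $ j = S $ j $ i}) \<inter> (\<Inter>v. {S. 0 \<le> v \<bullet> (S *v v)})
        \<inter> (\<Inter>i. {S. S $ i $ i = 1})"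
      by (auto simp: feasible_def psd_def transpose_def vec_eq_iff)
    have [continuous_intros]: "continuous_on UNIV (\<lambda>S::real^'k^'k. v \<bullet> (S *v v))" for v
      by (simp add: matrix_vector_mult_def inner_vec_def) (intro continuous_intros)
    show ?thesis unfolding eq
      by (intro closed_Int closed_INT closed_Collect_eq closed_Collect_le continuous_intros ballI)
  qed
  have bd: "bounded (feasible :: (real^'k^'k) set)"
  proof (rule boundedI)
    fix S :: "real^'k^'k" assume S: "S \<in> feasible"
    have "norm S \<le> (\<Sum>i\<in>UNIV. norm (S $ i))" unfolding norm_vec_def[of S] by (rule L2_set_le_sum) auto
    also have "\<dots> \<le> (\<Sum>i\<in>(UNIV::'k set). \<Sum>j\<in>(UNIV::'k set). 1)"
      by (intro sum_mono order_trans[OF norm_le_l1_cart] entry[OF S])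
    finally show "norm S \<le> (\<Sum>i\<in>(UNIV::'k set). \<Sum>j\<in>(UNIV::'k set). 1)" .
  qed
  have tr: "trace (A ** S) \<le> (\<Sum>i\<in>UNIV. \<Sum>j\<in>UNIV. \<bar>A $ i $ j\<bar>)"
      "- trace (A ** S) \<le> (\<Sum>i\<in>UNIV. \<Sum>j\<in>UNIV. \<bar>A $ i $ j\<bar>)" if "S \<in> feasible" for S
  proof -
    have "\<bar>trace (A ** S)\<bar> \<le> (\<Sum>i\<in>UNIV. \<Sum>j\<in>UNIV. \<bar>A $ i $ j\<bar>)"
      unfolding trace_def matrix_matrix_mult_def using entry[OF that]
      by (auto intro!: order_trans[OF sum_abs] sum_mono simp: abs_mult mult_left_le)
    then show "trace (A ** S) \<le> (\<Sum>i\<in>UNIV. \<Sum>j\<in>UNIV. \<bar>A $ i $ j\<bar>)"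
      "- trace (A ** S) \<le> (\<Sum>i\<in>UNIV. \<Sum>j\<in>UNIV. \<bar>A $ i $ j\<bar>)" by linarith+
  qed
  define a where "a = (\<Sum>i\<in>UNIV. \<Sum>j\<in>UNIV. \<bar>A $ i $ j\<bar>)"
  \<comment> \<open>The trace terms of two feasible matrices differ by at most
    \<open>2 * \<bar>\<beta>\<bar> * a\<close>, which is exactly \<open>- ln c / 2\<close>.\<close>
  define c where "c = exp (- 4 * \<bar>\<beta>\<bar> * a)"
  have a0: "a \<ge> 0" unfolding a_def by (intro sum_nonneg) auto
  have btr: "\<bar>\<beta> * trace (A ** S)\<bar> \<le> \<bar>\<beta>\<bar> * a" if "S \<in> feasible" for S
    using tr[OF that] by (auto simp: abs_mult a_def intro!: mult_left_mono)
  define K where "K = feasible \<inter> {S::real^'k^'k. c \<le> det S}"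
  have cdet: "continuous_on X (\<lambda>S::real^'k^'k. det S)" for X
    unfolding det_def by (intro continuous_intros)
  have ctr: "continuous_on X (\<lambda>S::real^'k^'k. trace (A ** S))" for X
    unfolding trace_def matrix_matrix_mult_def by (simp, intro continuous_intros)
  have K: "compact K" unfolding K_def
    using cl bd by (intro compact_Int_closed closed_Collect_le cdet continuous_intros) (simp add: compact_eq_bounded_closed)
  have c0: "0 < c" "c \<le> 1" using a0 by (auto simp: c_def)
  have I: "mat 1 \<in> (feasible :: (real^'k^'k) set)"
    by (simp add: feasible_def psd_def transpose_mat) (simp add: mat_def)
  then have IK: "mat 1 \<in> K" using c0 by (simp add: K_def)
  have "continuous_on K h" unfolding h_def
    by (intro continuous_intros cdet ctr) (use c0 in \<open>auto simp: K_def\<close>)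
  then obtain S where S: "S \<in> K" "\<And>T. T \<in> K \<Longrightarrow> h T \<le> h S"
    using continuous_attains_sup[OF K] IK by blast
  have ob: "objective \<beta> A T = ereal (h T)" if "det T > 0" for T
    using that by (simp add: objective_def h_def log_det_def)
  have Sd: "det S > 0" using S(1) c0 by (auto simp: K_def)
  have "objective \<beta> A T \<le> objective \<beta> A S" if T: "T \<in> feasible" for T
  proof (cases "det T > 0")
    case True
    show ?thesis
    proof (cases "T \<in> K")
      case False
      then have "ln (det T) \<le> ln c" using T True c0 by (auto simp: K_def)
      then have "h T \<le> \<beta> * trace (A ** mat 1)"
        using btr[OF T] btr[OF I] by (simp add: h_def c_def abs_le_iff)
      also have "\<dots> \<le> h S" using S(2)[OF IK] by (simp add: h_def)
      finally show ?thesis using True Sd by (simp add: ob)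
    qed (use True Sd S(2) in \<open>simp add: ob\<close>)
  qed (simp add: objective_def log_det_def)
  then show ?thesis using that S(1) Sd by (auto simp: K_def)
qed

lemma sum_symmetric_pair:
  fixes f :: "'k::finite \<Rightarrow> 'k \<Rightarrow> real"
  assumes "i \<noteq> j"
  shows "(\<Sum>a\<in>UNIV. \<Sum>b\<in>UNIV. f a b * (if a = i \<and> b = j \<or> a = j \<and> b = i then 1 else 0)) = f i j + f j i"
proof -
  have "(\<Sum>b\<in>UNIV. f a b * (if a = i \<and> b = j \<or> a = j \<and> b = i then 1 else 0)) =
      (if a = i then f a j else 0) + (if a = j then f a i else 0)" for a
    using assms by (auto simp: if_distrib cong: if_cong)
  then show ?thesis by (simp add: sum.distrib)
qed

text \<open>Changing the symmetric pair of entries (i, j) preserves the unit diagonal, so the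
  derivative of the objective in that direction vanishes. The diagonal of P + 2\<beta>A remains
  free: its entries are the Lagrange multipliers.\<close>

lemma maximizer_stationary:
  fixes A S :: "real^'k^'k"
  assumes A: "transpose A = A" and S: "S \<in> feasible" "det S > 0"
    and max: "\<And>T. T \<in> feasible \<Longrightarrow> objective \<beta> A T \<le> objective \<beta> A S"
    and P: "S ** P = mat 1" "transpose P = P" and ij: "i \<noteq> j"
  shows "P $ i $ j = - 2 * \<beta> * A $ i $ j"
proof -
  define D :: "real^'k^'k" where "D = (\<chi> a b. if a = i \<and> b = j \<or> a = j \<and> b = i then 1 else 0)"
  have psd: "psd S" using S by (simp add: feasible_def)
  obtain m where m: "m > 0" "\<And>v. m * (v \<bullet> v) \<le> v \<bullet> (S *v v)"
    using psd_det_pos_coercive[OF psd S(2)] by blast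
  have Dv: "v \<bullet> (D *v v) = 2 * v $ i * v $ j" for v
    using sum_symmetric_pair[OF ij, of "\<lambda>a b. v $ a * v $ b"]
    by (simp add: inner_vec_def matrix_vector_mult_def D_def sum_distrib_left mult_ac)
  \<comment> \<open>This bound has the shape of the coercivity estimate, so
    \<open>S + t *\<^sub>R D\<close> stays semidefinite for
    \<open>\<bar>t\<bar> \<le> m\<close>.\<close>
  have Db: "\<bar>v \<bullet> (D *v v)\<bar> \<le> v \<bullet> v" for v
  proof -
    have "(v $ i)^2 + (v $ j)^2 = (\<Sum>a\<in>{i,j}. (v $ a)^2)" using ij by simp
    also have "\<dots> \<le> (\<Sum>a\<in>UNIV. (v $ a)^2)" by (rule sum_mono2) auto
    also have "\<dots> = v \<bullet> v" by (simp add: inner_vec_def power2_eq_square)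
    finally show ?thesis
      using sum_squares_bound[of "v $ i" "v $ j"] sum_squares_bound[of "v $ i" "- v $ j"] by (simp add: Dv abs_le_iff)
  qed
  have feas: "S + t *\<^sub>R D \<in> feasible" if t: "\<bar>t\<bar> \<le> m" for t
  proof -
    have "0 \<le> v \<bullet> ((S + t *\<^sub>R D) *v v)" for v
    proof -
      have "\<bar>t * (v \<bullet> (D *v v))\<bar> \<le> m * (v \<bullet> v)"
        unfolding abs_mult by (intro mult_mono t Db) (use m in auto)
      then show ?thesis using m(2)[of v]
        by (simp add: matrix_vector_mult_add_rdistrib scaleR_matrix_vector_assoc[symmetric] inner_add_right abs_le_iff)
    qed
    moreover have "transpose (S + t *\<^sub>R D) = S + t *\<^sub>R D"
      using psd by (auto simp: psd_def transpose_def vec_eq_iff D_def)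
    ultimately show ?thesis using S(1) ij by (auto simp: feasible_def psd_def D_def)
  qed
  define g where "g t = \<beta> * trace (A ** (S + t *\<^sub>R D)) + ln (det (S + t *\<^sub>R D)) / 2" for t
  \<comment> \<open>Factoring out \<open>S\<close> moves the base point of the determinant to the
    identity matrix.\<close>
  have dd: "det (S + t *\<^sub>R D) = det S * det (mat 1 + t *\<^sub>R (P ** D))" for t
  proof -
    have "S + t *\<^sub>R D = S ** (mat 1 + t *\<^sub>R (P ** D))"
      by (simp add: matrix_add_ldistrib matrix_scalar_ac scalar_matrix_assoc[symmetric] matrix_mul_assoc P)
    then show ?thesis by (simp add: det_mul)
  qed
  have der: "((\<lambda>t. det (S + t *\<^sub>R D)) has_real_derivative det S * trace (P ** D)) (at 0)"
    unfolding dd by (intro DERIV_cmult has_real_derivative_det_mat_1)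
  have lin: "trace (A ** (S + t *\<^sub>R D)) = trace (A ** S) + t * trace (A ** D)" for t
    by (simp add: trace_def matrix_matrix_mult_def sum_distrib_left distrib_left sum.distrib mult.left_commute)
  have gd: "(g has_real_derivative \<beta> * trace (A ** D) + trace (P ** D) / 2) (at 0)"
    unfolding g_def lin using S(2)
    by (auto intro!: derivative_eq_intros der)
  \<comment> \<open>Only where the determinant is positive does the extended-real objective coincide
    with the differentiable function \<open>g\<close>.\<close>
  have "eventually (\<lambda>t. det (S + t *\<^sub>R D) > 0) (at 0)"
    using DERIV_isCont[OF der] S(2) by (intro order_tendstoD(1)[where y = "det S"]) (auto simp: isCont_def)
  then obtain e where e: "e > 0" "\<And>t. t \<noteq> 0 \<Longrightarrow> \<bar>t\<bar> < e \<Longrightarrow> det (S + t *\<^sub>R D) > 0"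
    by (auto simp: eventually_at dist_real_def)
  have "g t \<le> g 0" if t: "\<bar>0 - t\<bar> < min e m" for t
  proof -
    have p: "det (S + t *\<^sub>R D) > 0" using e(2)[of t] t S(2) by (cases "t = 0") auto
    have "objective \<beta> A (S + t *\<^sub>R D) \<le> objective \<beta> A S" using t by (intro max feas) auto
    then show ?thesis using p S(2) by (simp add: objective_def log_det_def g_def)
  qed
  then have z: "\<beta> * trace (A ** D) + trace (P ** D) / 2 = 0"
    using DERIV_local_max[OF gd, of "min e m"] e(1) m(1) by auto
  have trD: "trace (B ** D) = B $ i $ j + B $ j $ i" for B :: "real^'k^'k"
    using sum_symmetric_pair[OF ij, of "\<lambda>a b. B $ a $ b"]
    by (simp add: trace_def matrix_matrix_mult_def D_def disj_commute conj_commute)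
  have "A $ j $ i = A $ i $ j" "P $ j $ i = P $ i $ j"
    using A P(2) by (metis transpose_def vec_lambda_beta)+
  then show ?thesis using z by (simp add: trD)
qed

section \<open>Factorisation of a positive definite matrix\<close>

text \<open>Gram-Schmidt for the inner product given by \<open>S\<close>. As long as fewer than
  \<open>CARD('k)\<close> vectors are chosen, a dimension count provides a vector outside their
  span.\<close>

lemma exists_orthonormal_for_form:
  fixes S :: "real^'k^'k"
  assumes sym: "transpose S = S" and pd: "\<And>v. v \<noteq> 0 \<Longrightarrow> 0 < v \<bullet> (S *v v)" and "m \<le> CARD('k)"
  shows "\<exists>f::nat \<Rightarrow> real^'k. \<forall>a<m. \<forall>b<m. f a \<bullet> (S *v f b) = (if a = b then 1 else 0)"
  using \<open>m \<le> CARD('k)\<close>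
proof (induction m)
  case (Suc m)
  then obtain f :: "nat \<Rightarrow> real^'k"
    where f: "\<And>a b. a < m \<Longrightarrow> b < m \<Longrightarrow> f a \<bullet> (S *v f b) = (if a = b then 1 else 0)" by auto
  have sw: "u \<bullet> (S *v v) = v \<bullet> (S *v u)" for u v
    by (metis dot_lmul_matrix inner_commute sym transpose_matrix_vector)
  have "dim (f ` {..<m}) \<le> m"
    by (metis card_image_le card_lessThan dim_le_card' finite_imageI finite_lessThan order_trans)
  then have "dim (f ` {..<m}) < dim (UNIV :: (real^'k) set)" using Suc.prems by simp
  then have "span (f ` {..<m}) \<noteq> UNIV" by (metis dim_span less_irrefl)
  then obtain v where v: "v \<notin> span (f ` {..<m})" by auto
  define w where "w = v - (\<Sum>a<m. (f a \<bullet> (S *v v)) *\<^sub>R f a)"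
  have "(\<Sum>a<m. (f a \<bullet> (S *v v)) *\<^sub>R f a) \<in> span (f ` {..<m})"
    by (intro span_sum span_scale span_base) auto
  then have w0: "w \<noteq> 0" using v by (auto simp: w_def)
  have fw: "f a \<bullet> (S *v w) = 0" if "a < m" for a
  proof -
    have "(\<Sum>b<m. (f b \<bullet> (S *v v)) * (f a \<bullet> (S *v f b))) = (\<Sum>b<m. if b = a then f b \<bullet> (S *v v) else 0)"
      using f that by (intro sum.cong) auto
    then show ?thesis using that
      by (simp add: w_def matrix_vector_mult_diff_distrib linear_sum[OF matrix_vector_mul_linear]
          matrix_vector_mult_scaleR inner_diff_right inner_sum_right)
  qed
  have wf: "w \<bullet> (S *v f a) = 0" if "a < m" for a using fw[OF that] sw by metis
  define c where "c = sqrt (w \<bullet> (S *v w))"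
  have c: "c > 0" "w \<bullet> (S *v w) = c * c" using pd[OF w0] by (auto simp: c_def)
  define f' where "f' = f(m := w /\<^sub>R c)"
  have "f' a \<bullet> (S *v f' b) = (if a = b then 1 else 0)" if "a < Suc m" "b < Suc m" for a b
    using that f[of a b] fw[of a] wf[of b] c
    by (auto simp: f'_def matrix_vector_mult_scaleR less_Suc_eq field_simps)
  then show ?case by blast
qed simp

text \<open>If the rows of \<open>W\<close> are orthonormal for the form, then W S W^T = 1. Hence V
  = S W^T is the inverse of \<open>W\<close>, and V V^T = S (V W)^T = S.\<close>

lemma psd_det_pos_factor:
  fixes S :: "real^'k^'k"
  assumes "psd S" "det S > 0"
  obtains L :: "real^'k^'k" where "L ** transpose L = S"
proof -
  have sym: "transpose S = S" using assms by (simp add: psd_def)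
  obtain f :: "nat \<Rightarrow> real^'k"
    where f: "\<And>a b. a < CARD('k) \<Longrightarrow> b < CARD('k) \<Longrightarrow> f a \<bullet> (S *v f b) = (if a = b then 1 else 0)"
    using exists_orthonormal_for_form[OF sym psd_det_pos_quadratic_pos[OF assms] order_refl] by auto
  obtain h where h: "bij_betw h (UNIV :: 'k set) {..<CARD('k)}"
    using ex_bij_betw_finite_nat[of "UNIV :: 'k set"] by (auto simp: atLeast0LessThan)
  define W :: "real^'k^'k" where "W = (\<chi> a. f (h a))"
  have "W ** S ** transpose W = mat 1"
  proof -
    have "(W ** S ** transpose W) $ a $ b = f (h a) \<bullet> (S *v f (h b))" for a b
      by (simp add: matrix_mul_assoc[symmetric])
        (simp add: matrix_matrix_mult_def matrix_vector_mult_def inner_vec_def transpose_def W_def)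
    moreover have "h a = h b \<longleftrightarrow> a = b" for a b using h by (auto simp: bij_betw_def inj_on_def)
    ultimately show ?thesis using f bij_betwE[OF h] by (simp add: vec_eq_iff mat_def)
  qed
  then have W: "W ** (S ** transpose W) = mat 1" by (simp add: matrix_mul_assoc)
  define V where "V = S ** transpose W"
  have "V ** W = mat 1" using W V_def matrix_left_right_inverse by blast
  have "V ** transpose V = S ** (transpose W ** transpose V)" by (simp add: V_def matrix_mul_assoc)
  also have "transpose W ** transpose V = transpose (V ** W)" by (simp add: matrix_transpose_mul)
  also have "\<dots> = mat 1" using \<open>V ** W = mat 1\<close> by (simp add: transpose_mat)
  finally show ?thesis using that by simp
qed

subsection \<open>Linear change of variables for tuples of vectors\<close>

text \<open>The assumption on \<open>c\<close> says that each factor is \<open>c i\<close> times its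
  own image under \<open>T i\<close>; for the products this is checked on boxes. It serves on two
  levels: for the coordinates of one vector and for the vectors of a tuple under a diagonal
  matrix.\<close>

lemma nn_integral_PiM_map:
  fixes M :: "'i \<Rightarrow> 'a measure" and c :: "'i \<Rightarrow> ennreal"
  assumes I: "finite I" and M: "product_sigma_finite M"
    and T: "\<And>i. i \<in> I \<Longrightarrow> T i \<in> measurable (M i) (M i)"
    and c: "\<And>i A. i \<in> I \<Longrightarrow> A \<in> sets (M i) \<Longrightarrow>
        emeasure (M i) A = c i * emeasure (M i) (T i -` A \<inter> space (M i))"
    and f: "f \<in> borel_measurable (PiM I M)"
  shows "(\<integral>\<^sup>+x. f x \<partial>PiM I M) = (\<Prod>i\<in>I. c i) * (\<integral>\<^sup>+x. f (\<lambda>i\<in>I. T i (x i)) \<partial>PiM I M)"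
proof -
  interpret product_sigma_finite M by fact
  let ?T = "\<lambda>x. \<lambda>i\<in>I. T i (x i)"
  have T': "?T \<in> measurable (PiM I M) (PiM I M)"
    by (intro measurable_restrict measurable_compose[OF measurable_component_singleton]) (use T in auto)
  have "scale_measure (\<Prod>i\<in>I. c i) (distr (PiM I M) (PiM I M) ?T) = PiM I M"
  proof (rule PiM_eqI)
    fix A assume A: "\<And>i. i \<in> I \<Longrightarrow> A i \<in> sets (M i)"
    have vim: "?T -` PiE I A \<inter> space (PiM I M) = PiE I (\<lambda>i. T i -` A i \<inter> space (M i))"
      by (auto simp: space_PiM PiE_iff)
    show "emeasure (scale_measure (\<Prod>i\<in>I. c i) (distr (PiM I M) (PiM I M) ?T)) (PiE I A) = (\<Prod>i\<in>I. emeasure (M i) (A i))"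
      using A I T'
      by (simp add: emeasure_distr sets_PiM_I_finite vim emeasure_PiM measurable_sets[OF T] prod.distrib[symmetric] c)
  qed (use I in auto)
  then have "(\<integral>\<^sup>+x. f x \<partial>PiM I M) = (\<integral>\<^sup>+x. f x \<partial>scale_measure (\<Prod>i\<in>I. c i) (distr (PiM I M) (PiM I M) ?T))"
    by simp
  also have "\<dots> = (\<Prod>i\<in>I. c i) * (\<integral>\<^sup>+x. f (?T x) \<partial>PiM I M)"
    using f T' by (subst nn_integral_scale_measure) (auto simp: nn_integral_distr)
  finally show ?thesis .
qed

lemma product_sigma_finite_lborel: "product_sigma_finite (\<lambda>_. lborel)"
  by (simp add: product_sigma_finite_def sigma_finite_lborel)

lemma sigma_finite_lebesgue_n: "sigma_finite_measure (lebesgue_n n)"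
proof -
  interpret product_sigma_finite "\<lambda>_::nat. lborel :: real measure" by (rule product_sigma_finite_lborel)
  show ?thesis by (rule sigma_finite) simp
qed

lemma product_sigma_finite_lebesgue_n: "product_sigma_finite (\<lambda>_. lebesgue_n n)"
  by (simp add: product_sigma_finite_def sigma_finite_lebesgue_n)

lemma nn_integral_lebesgue_n_affine:
  assumes "c \<noteq> 0" "f \<in> borel_measurable (lebesgue_n n)"
  shows "(\<integral>\<^sup>+y. f y \<partial>lebesgue_n n) = ennreal (\<bar>c\<bar> ^ n) * (\<integral>\<^sup>+y. f (\<lambda>l\<in>{..<n}. v l + c * y l) \<partial>lebesgue_n n)"
proof -
  have "emeasure lborel A = ennreal \<bar>c\<bar> * emeasure lborel ((\<lambda>x. v l + c * x) -` A \<inter> space lborel)"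
    if "A \<in> sets lborel" for A :: "real set" and l
  proof -
    have m: "(\<lambda>x. v l + c * x) -` A \<inter> space lborel \<in> sets lborel"
      by (rule measurable_sets[OF _ that]) simp
    have "(\<lambda>x. indicator A (v l + c * x) :: ennreal) = indicator ((\<lambda>x. v l + c * x) -` A \<inter> space lborel)"
      by (auto simp: indicator_def)
    then have "(\<integral>\<^sup>+x. indicator A (v l + c * x) \<partial>lborel) = emeasure lborel ((\<lambda>x. v l + c * x) -` A \<inter> space lborel)"
      using nn_integral_indicator[OF m] by simp
    then show ?thesis
      using nn_integral_real_affine[of "indicator A" c "v l"] assms(1) that by simp
  qed
  then show ?thesis
    using nn_integral_PiM_map[OF _ product_sigma_finite_lborel, of "{..<n}" "\<lambda>l x. v l + c * x" "\<lambda>_. ennreal \<bar>c\<bar>" f] assms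
    by (simp add: ennreal_power)
qed

text \<open>The tensor product of \<open>A\<close> with the identity of n-space: the same
  \<open>A\<close> acts on every coordinate \<open>l\<close>. The restriction keeps the values
  extensional, hence inside the space of the product measure.\<close>

definition mat_act :: "nat \<Rightarrow> real^'k^'k \<Rightarrow> ('k \<Rightarrow> nat \<Rightarrow> real) \<Rightarrow> 'k \<Rightarrow> nat \<Rightarrow> real" where
  "mat_act n A y = (\<lambda>i. \<lambda>l\<in>{..<n}. \<Sum>j\<in>UNIV. A $ i $ j * y j l)"

abbreviation lebesgue_kn :: "nat \<Rightarrow> ('k \<Rightarrow> nat \<Rightarrow> real) measure" where
  "lebesgue_kn n \<equiv> \<Pi>\<^sub>M i\<in>(UNIV :: 'k set). lebesgue_n n"

lemma measurable_PiM_entry [measurable (raw)]: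
  "l < n \<Longrightarrow> (\<lambda>x. x i l) \<in> borel_measurable (\<Pi>\<^sub>M i\<in>(UNIV::'k set). lebesgue_n n)"
  using measurable_compose[OF measurable_component_singleton[of i UNIV "\<lambda>_. lebesgue_n n"]
      measurable_component_singleton[of l "{..<n}" "\<lambda>_. lborel"]] by simp

lemma measurable_PiM_UNIV:
  "(\<And>i. (\<lambda>x. f x i) \<in> measurable N M) \<Longrightarrow> f \<in> measurable N (\<Pi>\<^sub>M i\<in>UNIV. M)"
  using measurable_restrict[of UNIV "\<lambda>i x. f x i" N "\<lambda>_. M"] by (simp add: restrict_def)

lemma mat_act_measurable [measurable]: "mat_act n A \<in> measurable (lebesgue_kn n) (lebesgue_kn n)"
  unfolding mat_act_def measurable_lborel1[symmetric]
  by (intro measurable_PiM_UNIV measurable_restrict) (auto intro!: borel_measurable_sum borel_measurable_times measurable_PiM_entry)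

lemma nn_integral_PiM_permute:
  fixes M :: "'a measure" and p :: "'i::finite \<Rightarrow> 'i"
  assumes M: "sigma_finite_measure M" and p: "bij p"
    and f: "f \<in> borel_measurable (\<Pi>\<^sub>M i\<in>UNIV. M)"
  shows "(\<integral>\<^sup>+x. f x \<partial>(\<Pi>\<^sub>M i\<in>UNIV. M)) = (\<integral>\<^sup>+x. f (\<lambda>i. x (p i)) \<partial>(\<Pi>\<^sub>M i\<in>UNIV. M))"
proof -
  interpret product_sigma_finite "\<lambda>_::'i. M" using M by (simp add: product_sigma_finite_def)
  let ?P = "\<Pi>\<^sub>M i\<in>(UNIV::'i set). M"
  have T: "(\<lambda>x i. x (p i)) \<in> measurable ?P ?P"
    by (intro measurable_PiM_UNIV) simp
  have "distr ?P ?P (\<lambda>x i. x (p i)) = ?P"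
  proof (rule PiM_eqI)
    fix A :: "'i \<Rightarrow> 'a set" assume A: "\<And>i. i \<in> UNIV \<Longrightarrow> A i \<in> sets M"
    have "(\<lambda>x i. x (p i)) -` PiE UNIV A \<inter> space ?P = PiE UNIV (\<lambda>i. A (inv p i))"
      using A[THEN sets.sets_into_space] p
      by (auto simp: space_PiM PiE_iff bij_is_inj bij_is_surj surj_f_inv_f) (metis bij_inv_eq_iff, metis bij_inv_eq_iff subsetD)
    moreover have "(\<Prod>i\<in>UNIV. emeasure M (A (inv p i))) = (\<Prod>i\<in>UNIV. emeasure M (A i))"
      using p by (intro prod.reindex_bij_betw bij_imp_bij_inv)
    ultimately show "emeasure (distr ?P ?P (\<lambda>x i. x (p i))) (PiE UNIV A) = (\<Prod>i\<in>UNIV. emeasure M (A i))"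
      using A T by (simp add: emeasure_distr sets_PiM_I_finite emeasure_PiM)
  qed auto
  then show ?thesis using f T by (metis nn_integral_distr)
qed

lemma mat_act_mult: "mat_act n A (mat_act n B y) = mat_act n (A ** B) y"
proof -
  have "(\<Sum>j\<in>UNIV. A $ i $ j * (\<Sum>m\<in>UNIV. B $ j $ m * y m l)) = (\<Sum>m\<in>UNIV. (A ** B) $ i $ m * y m l)" for i l
    by (simp add: matrix_matrix_mult_def sum_distrib_left sum_distrib_right mult.assoc) (rule sum.swap)
  then show ?thesis by (intro ext) (simp add: mat_act_def restrict_def)
qed

text \<open>The Jacobian of a tensor product with the identity of n-space is the n-th power of the
  determinant. Both sides behave multiplicatively under matrix products, so elementary matrices
  suffice.\<close>

theorem nn_integral_mat_act:
  fixes A :: "real^'k^'k"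
  assumes "det A \<noteq> 0" and f: "f \<in> borel_measurable (lebesgue_kn n)"
  shows "(\<integral>\<^sup>+x. f x \<partial>lebesgue_kn n) = ennreal (\<bar>det A\<bar> ^ n) * (\<integral>\<^sup>+x. f (mat_act n A x) \<partial>lebesgue_kn n)"
proof -
  let ?L = "lebesgue_kn n :: ('k \<Rightarrow> nat \<Rightarrow> real) measure"
  \<comment> \<open>The induction also passes through singular matrices, for instance those with a
    zero row; the implication makes the claim vacuous there.\<close>
  let ?P = "\<lambda>A::real^'k^'k. det A \<noteq> 0 \<longrightarrow> (\<forall>f\<in>borel_measurable ?L.
      (\<integral>\<^sup>+x. f x \<partial>?L) = ennreal (\<bar>det A\<bar> ^ n) * (\<integral>\<^sup>+x. f (mat_act n A x) \<partial>?L))"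
  interpret product_sigma_finite "\<lambda>_::'k. lebesgue_n n" by (rule product_sigma_finite_lebesgue_n)
  have sp: "restrict (x i) {..<n} = x i" if "x \<in> space ?L" for x i
    using that by (simp add: space_PiM PiE_iff extensional_restrict)
  have "?P A"
  proof (rule induct_matrix_elementary)
    fix A B :: "real^'k^'k" assume A: "?P A" and B: "?P B"
    show "?P (A ** B)"
    proof (intro impI ballI)
      fix f :: "_ \<Rightarrow> ennreal" assume d: "det (A ** B) \<noteq> 0" and f [measurable]: "f \<in> borel_measurable ?L"
      have d': "det A \<noteq> 0" "det B \<noteq> 0" using d by (auto simp: det_mul)
      have fA: "(\<lambda>x. f (mat_act n A x)) \<in> borel_measurable ?L" by measurable
      have "(\<integral>\<^sup>+x. f x \<partial>?L) = ennreal (\<bar>det A\<bar> ^ n) * (\<integral>\<^sup>+x. f (mat_act n A x) \<partial>?L)"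
        using A d' f by blast
      also have "(\<integral>\<^sup>+x. f (mat_act n A x) \<partial>?L) = ennreal (\<bar>det B\<bar> ^ n) * (\<integral>\<^sup>+x. f (mat_act n A (mat_act n B x)) \<partial>?L)"
        using B d' fA by blast
      finally show "(\<integral>\<^sup>+x. f x \<partial>?L) = ennreal (\<bar>det (A ** B)\<bar> ^ n) * (\<integral>\<^sup>+x. f (mat_act n (A ** B) x) \<partial>?L)"
        by (simp add: mat_act_mult det_mul abs_mult power_mult_distrib ennreal_mult mult.assoc)
    qed
  next
    fix A :: "real^'k^'k" and i assume "row i A = 0"
    then have "det A = 0" by (rule det_zero_row)
    then show "?P A" by simp
  next
    fix A :: "real^'k^'k" assume A: "\<And>i j. i \<noteq> j \<Longrightarrow> A $ i $ j = 0"
    show "?P A"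
    proof (intro impI ballI)
      fix f :: "_ \<Rightarrow> ennreal" assume d: "det A \<noteq> 0" and f: "f \<in> borel_measurable ?L"
      have dA: "det A = (\<Prod>i\<in>UNIV. A $ i $ i)" by (rule det_diagonal) (rule A)
      then have nz: "A $ i $ i \<noteq> 0" for i using d by auto
      have T: "(\<lambda>y. \<lambda>l\<in>{..<n}. 0 + A $ i $ i * y l) \<in> measurable (lebesgue_n n) (lebesgue_n n)" for i
        by (intro measurable_restrict) measurable
      have c: "emeasure (lebesgue_n n) B = ennreal (\<bar>A $ i $ i\<bar> ^ n) *
          emeasure (lebesgue_n n) ((\<lambda>y. \<lambda>l\<in>{..<n}. 0 + A $ i $ i * y l) -` B \<inter> space (lebesgue_n n))"
        if "B \<in> sets (lebesgue_n n)" for i B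
        using nn_integral_lebesgue_n_affine[OF nz borel_measurable_indicator[OF that], of i "\<lambda>_. 0"]
          measurable_sets[OF T that]
        by (simp add: nn_integral_indicator'[symmetric] that) (simp add: indicator_def)
      have act: "mat_act n A x = (\<lambda>i\<in>UNIV. \<lambda>l\<in>{..<n}. 0 + A $ i $ i * x i l)" for x
      proof -
        have "(\<Sum>j\<in>UNIV. A $ i $ j * x j l) = (\<Sum>j\<in>UNIV. if j = i then A $ i $ i * x i l else 0)" for i l
          using A by (intro sum.cong) auto
        then show ?thesis by (simp add: mat_act_def restrict_def fun_eq_iff)
      qed
      show "(\<integral>\<^sup>+x. f x \<partial>?L) = ennreal (\<bar>det A\<bar> ^ n) * (\<integral>\<^sup>+x. f (mat_act n A x) \<partial>?L)"
        unfolding act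
        using nn_integral_PiM_map[OF _ product_sigma_finite_lebesgue_n T c f]
        by (simp add: dA abs_prod prod_power_distrib[symmetric] prod_ennreal)
    qed
  next
    fix a b :: 'k assume ab: "a \<noteq> b"
    let ?A = "(\<chi> i j. mat 1 $ i $ Transposition.transpose a b j) :: real^'k^'k"
    show "?P ?A"
    proof (intro impI ballI)
      fix f :: "_ \<Rightarrow> ennreal" assume f: "f \<in> borel_measurable ?L"
      have "det ?A = of_int (sign (Transposition.transpose a b)) * det (mat 1 :: real^'k^'k)"
        by (rule det_permute_columns) (simp add: permutes_swap_id)
      then have d: "\<bar>det ?A\<bar> = 1" by (simp add: sign_swap_id abs_mult)
      \<comment> \<open>The restriction in \<open>mat_act\<close> leaves \<open>x\<close> unchanged
        only because its components are extensional, hence the condition on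
        \<open>x\<close>.\<close>
      have act: "mat_act n ?A x = (\<lambda>i. x (Transposition.transpose a b i))" if "x \<in> space ?L" for x
      proof (intro ext)
        fix i l
        have "(\<Sum>j\<in>UNIV. ?A $ i $ j * x j l) = (\<Sum>j\<in>UNIV. if j = Transposition.transpose a b i then x j l else 0)"
          by (intro sum.cong) (auto simp: mat_def)
        then show "mat_act n ?A x i l = x (Transposition.transpose a b i) l"
          using fun_cong[OF sp[OF that, of "Transposition.transpose a b i"], of l]
          by (simp add: mat_act_def restrict_def split: if_splits)
      qed
      show "(\<integral>\<^sup>+x. f x \<partial>?L) = ennreal (\<bar>det ?A\<bar> ^ n) * (\<integral>\<^sup>+x. f (mat_act n ?A x) \<partial>?L)"
        using nn_integral_PiM_permute[OF sigma_finite_lebesgue_n _ f, of "Transposition.transpose a b"]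
        by (simp add: d act cong: nn_integral_cong)
    qed
  next
    fix a b :: 'k and c assume ab: "a \<noteq> b"
    let ?A = "(\<chi> i j. if i = a \<and> j = b then c else of_bool (i = j)) :: real^'k^'k"
    show "?P ?A"
    proof (intro impI ballI)
      fix f :: "_ \<Rightarrow> ennreal" assume f [measurable]: "f \<in> borel_measurable ?L"
      have "?A = (\<chi> i. if i = a then row a (mat 1) + c *s row b (mat 1) else row i (mat 1))"
        using ab by (auto simp: vec_eq_iff row_def mat_def)
      then have d: "det ?A = 1" using det_row_operation[OF ab, of "mat 1" c] by simp
      have act: "mat_act n ?A (x(a := y)) = x(a := \<lambda>l\<in>{..<n}. c * x b l + 1 * y l)"
        if x: "x \<in> space (\<Pi>\<^sub>M i\<in>UNIV - {a}. lebesgue_n n)" for x y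
      proof (intro ext)
        fix i l
        have *: "(\<Sum>j\<in>UNIV. ?A $ i $ j * (x(a := y)) j l) = (\<Sum>j\<in>UNIV. (if j = i then (x(a := y)) j l else 0) + (if j = b then (if i = a then c * x b l else 0) else 0))"
          using ab by (intro sum.cong) auto
        have "x i \<in> extensional {..<n}" if "i \<noteq> a"
          using that x by (auto simp: space_PiM PiE_iff)
        then show "mat_act n ?A (x(a := y)) i l = (x(a := \<lambda>l\<in>{..<n}. c * x b l + 1 * y l)) i l"
          unfolding mat_act_def restrict_apply * by (auto simp: sum.distrib extensional_def)
      qed
      have I: "insert a (UNIV - {a}) = UNIV" by auto
      \<comment> \<open>Once all vectors except the one at \<open>a\<close> are fixed, the shear is
        a translation of that vector, and Lebesgue measure is translation invariant.\<close>
      have split: "(\<integral>\<^sup>+x. g x \<partial>?L) = (\<integral>\<^sup>+x. (\<integral>\<^sup>+y. g (x(a := y)) \<partial>lebesgue_n n) \<partial>(\<Pi>\<^sub>M i\<in>UNIV - {a}. lebesgue_n n))"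
        if "g \<in> borel_measurable ?L" for g :: "('k \<Rightarrow> nat \<Rightarrow> real) \<Rightarrow> ennreal"
        using product_nn_integral_insert[of "UNIV - {a}" a g] that by (simp add: I)
      have "(\<integral>\<^sup>+y. f (x(a := y)) \<partial>lebesgue_n n) = (\<integral>\<^sup>+y. f (mat_act n ?A (x(a := y))) \<partial>lebesgue_n n)"
        if x: "x \<in> space (\<Pi>\<^sub>M i\<in>UNIV - {a}. lebesgue_n n)" for x
      proof -
        have "(\<lambda>y. x(a := y)) \<in> measurable (lebesgue_n n) ?L"
          using x measurable_component_update[of x "UNIV - {a}" "\<lambda>_. lebesgue_n n" a] by (simp add: I)
        then have "(\<lambda>y. f (x(a := y))) \<in> borel_measurable (lebesgue_n n)" by measurable
        then show ?thesis unfolding act[OF x]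
          by (subst nn_integral_lebesgue_n_affine[of 1 _ _ "\<lambda>l. c * x b l"]) auto
      qed
      then show "(\<integral>\<^sup>+x. f x \<partial>?L) = ennreal (\<bar>det ?A\<bar> ^ n) * (\<integral>\<^sup>+x. f (mat_act n ?A x) \<partial>?L)"
        unfolding d by (simp add: split cong: nn_integral_cong)
    qed
  qed
  then show ?thesis using assms by blast
qed

subsection \<open>Polar coordinates\<close>

lemma lebesgue_n_component_measurable:
  "g \<in> measurable M (lebesgue_n n) \<Longrightarrow> l < n \<Longrightarrow> (\<lambda>x. g x l) \<in> borel_measurable M"
  unfolding measurable_lborel1[symmetric]
  by (rule measurable_compose[of g M "lebesgue_n n" "\<lambda>x. x l"], assumption, rule measurable_component_singleton, simp)

lemma inner_n_measurable [measurable]: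
  "f \<in> measurable M (lebesgue_n n) \<Longrightarrow> g \<in> measurable M (lebesgue_n n) \<Longrightarrow>
    (\<lambda>x. inner_n n (f x) (g x)) \<in> borel_measurable M"
  unfolding inner_n_def
  by (intro borel_measurable_sum borel_measurable_times lebesgue_n_component_measurable; (assumption | simp))

lemma norm_n_measurable [measurable]:
  "f \<in> measurable M (lebesgue_n n) \<Longrightarrow> (\<lambda>x. norm_n n (f x)) \<in> borel_measurable M"
  unfolding norm_n_def by (rule measurable_compose[OF inner_n_measurable borel_measurable_sqrt])

lemma normalize_n_measurable [measurable]: "normalize_n n \<in> measurable (lebesgue_n n) (lebesgue_n n)"
  unfolding normalize_n_def
  by (intro measurable_restrict, unfold measurable_lborel1)
    (intro borel_measurable_divide lebesgue_n_component_measurable norm_n_measurable, auto)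

definition scale_n :: "nat \<Rightarrow> real \<Rightarrow> (nat \<Rightarrow> real) \<Rightarrow> nat \<Rightarrow> real" where
  "scale_n n t x = (\<lambda>l\<in>{..<n}. t * x l)"

lemma scale_n_measurable [measurable]:
  "f \<in> borel_measurable M \<Longrightarrow> g \<in> measurable M (lebesgue_n n) \<Longrightarrow>
    (\<lambda>x. scale_n n (f x) (g x)) \<in> measurable M (lebesgue_n n)"
  unfolding scale_n_def
  by (intro measurable_restrict, unfold measurable_lborel1)
    (rule borel_measurable_times, assumption, rule lebesgue_n_component_measurable, assumption, simp)

lemma inner_n_scale_n: "inner_n n (scale_n n s x) (scale_n n t y) = s * t * inner_n n x y"
  by (simp add: inner_n_def scale_n_def sum_distrib_left mult_ac)

lemma inner_n_self_nonneg: "0 \<le> inner_n n x x"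
  by (simp add: inner_n_def sum_nonneg)

lemma norm_n_nonneg: "0 \<le> norm_n n x"
  by (simp add: norm_n_def inner_n_self_nonneg)

lemma norm_n_scale_n: "0 \<le> t \<Longrightarrow> norm_n n (scale_n n t x) = t * norm_n n x"
  by (simp add: norm_n_def inner_n_scale_n real_sqrt_mult)

lemma normalize_n_eq_scale_n: "normalize_n n x = scale_n n (inverse (norm_n n x)) x"
  by (simp add: normalize_n_def scale_n_def divide_inverse mult.commute)

lemma scale_n_scale_n: "scale_n n s (scale_n n t x) = scale_n n (s * t) x"
  by (auto simp: scale_n_def mult.assoc restrict_def)

lemma norm_n_normalize_n: "0 < norm_n n x \<Longrightarrow> norm_n n (normalize_n n x) = 1"
  by (simp add: normalize_n_eq_scale_n norm_n_scale_n)

lemma sets_sphere_delta [measurable_cong]: "sets (sphere_delta n) = sets (lebesgue_n n)"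
  by (simp add: sphere_delta_def sphere_measure_def)

lemma nn_integral_sphere_delta:
  assumes f [measurable]: "f \<in> borel_measurable (lebesgue_n n)"
  shows "(\<integral>\<^sup>+u. f u \<partial>sphere_delta n) = ennreal (real n / 2) *
    (\<integral>\<^sup>+x. f (normalize_n n x) * indicator {x. 0 < norm_n n x \<and> norm_n n x \<le> 1} x \<partial>lebesgue_n n)"
proof -
  let ?B = "{x. 0 < norm_n n x \<and> norm_n n x \<le> 1}"
  have B: "?B \<inter> space (lebesgue_n n) \<in> sets (lebesgue_n n)" by measurable
  have "normalize_n n \<in> measurable (restrict_space (lebesgue_n n) ?B) (lebesgue_n n)"
    by (intro measurable_restrict_space1) measurable
  then have "(\<integral>\<^sup>+u. f u \<partial>sphere_delta n) = ennreal (1/2) * (of_nat n *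
      (\<integral>\<^sup>+x. f (normalize_n n x) \<partial>restrict_space (lebesgue_n n) ?B))"
    unfolding sphere_delta_def sphere_measure_def
    by (simp add: nn_integral_scale_measure nn_integral_distr mult.assoc)
  also have "(\<integral>\<^sup>+x. f (normalize_n n x) \<partial>restrict_space (lebesgue_n n) ?B) =
      (\<integral>\<^sup>+x. f (normalize_n n x) * indicator ?B x \<partial>lebesgue_n n)"
    using B by (simp add: nn_integral_restrict_space)
  also have "ennreal (1/2) * (of_nat n * c) = ennreal (real n / 2) * c" for c
  proof -
    have "ennreal (real n / 2) = ennreal (1/2) * ennreal (real n)"
      by (subst ennreal_mult[symmetric]) auto
    then show ?thesis by (simp only: ennreal_of_nat_eq_real_of_nat mult.assoc)
  qed
  finally show ?thesis .
qed

lemma AE_sphere_delta_norm: "AE u in sphere_delta n. norm_n n u = 1"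
proof -
  let ?N = "{u \<in> space (lebesgue_n n). norm_n n u \<noteq> 1}"
  have N: "?N \<in> sets (lebesgue_n n)" by measurable
  have "emeasure (sphere_delta n) ?N = (\<integral>\<^sup>+u. indicator ?N u \<partial>sphere_delta n)"
    using N by (simp add: sets_sphere_delta)
  also have "\<dots> = 0"
    using N by (subst nn_integral_sphere_delta)
      (auto simp: nn_integral_0_iff_AE indicator_def norm_n_normalize_n)
  finally show ?thesis
    using N by (intro AE_I'[of ?N]) (auto simp: null_sets_def sets_sphere_delta sets_eq_imp_space_eq[OF sets_sphere_delta])
qed

lemma finite_measure_sphere_delta: "finite_measure (sphere_delta n)"
proof
  interpret product_sigma_finite "\<lambda>_::nat. lborel :: real measure" by (rule product_sigma_finite_lborel)
  let ?B = "{x. 0 < norm_n n x \<and> norm_n n x \<le> 1}"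
  have "emeasure (sphere_delta n) (space (sphere_delta n)) = (\<integral>\<^sup>+u. 1 \<partial>sphere_delta n)" by simp
  also have "\<dots> = ennreal (real n / 2) * (\<integral>\<^sup>+x. indicator ?B x \<partial>lebesgue_n n)"
    by (subst nn_integral_sphere_delta) auto
  \<comment> \<open>The ball is enclosed in the cube with side 2, whose volume is explicit and
    finite.\<close>
  also have "(\<integral>\<^sup>+x. indicator ?B x \<partial>lebesgue_n n) \<le> (\<integral>\<^sup>+x. indicator (PiE {..<n} (\<lambda>_. {-1..1})) x \<partial>lebesgue_n n)"
  proof (rule nn_integral_mono)
    fix x assume x: "x \<in> space (lebesgue_n n)"
    have "x l \<in> {-1..1}" if "norm_n n x \<le> 1" "l < n" for l
    proof -
      have "(x l)\<^sup>2 \<le> inner_n n x x"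
        unfolding inner_n_def power2_eq_square using that(2) by (intro member_le_sum) auto
      also have "\<dots> \<le> 1" using that(1) by (simp add: norm_n_def)
      finally show ?thesis by (simp add: abs_square_le_1 abs_le_iff)
    qed
    then show "indicator ?B x \<le> (indicator (PiE {..<n} (\<lambda>_. {-1..1})) x :: ennreal)"
      using x by (auto simp: indicator_def space_PiM PiE_iff)
  qed
  also have "\<dots> = ennreal (2 ^ n)"
    by (subst nn_integral_indicator) (auto intro!: sets_PiM_I_finite simp: emeasure_PiM ennreal_power[symmetric])
  finally have "emeasure (sphere_delta n) (space (sphere_delta n)) \<le> ennreal (real n / 2) * ennreal (2 ^ n)"
    by (simp add: mult_left_mono)
  also have "\<dots> < \<infinity>" by (simp add: ennreal_mult_less_top)
  finally show "emeasure (sphere_delta n) (space (sphere_delta n)) \<noteq> \<infinity>" by simp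
qed

lemma AE_lebesgue_n_norm_pos:
  assumes "n > 0"
  shows "AE x in lebesgue_n n. 0 < norm_n n x"
proof -
  interpret product_sigma_finite "\<lambda>_::nat. lborel :: real measure" by (rule product_sigma_finite_lborel)
  \<comment> \<open>The zero vector lies in the null hyperplane where coordinate 0 vanishes;
    \<open>n > 0\<close> ensures that this coordinate exists.\<close>
  let ?N = "PiE {..<n} (\<lambda>l. if l = 0 then {0::real} else UNIV)"
  have "emeasure (lebesgue_n n) ?N = (\<Prod>l<n. emeasure lborel (if l = 0 then {0::real} else UNIV))"
    by (rule emeasure_PiM) auto
  also have "\<dots> = 0" using assms by (intro prod_zero) auto
  finally have N: "?N \<in> null_sets (lebesgue_n n)"
    by (auto simp: null_sets_def intro!: sets_PiM_I_finite)
  have "x \<in> ?N" if "x \<in> space (lebesgue_n n)" "\<not> 0 < norm_n n x" for x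
  proof -
    have "inner_n n x x = 0"
      using that(2) norm_n_nonneg[of n x] by (simp add: norm_n_def)
    then have "x 0 * x 0 = 0"
      using assms by (simp add: inner_n_def sum_nonneg_eq_0_iff)
    then show ?thesis using that(1) by (auto simp: space_PiM PiE_iff)
  qed
  then show ?thesis by (intro AE_I'[OF N]) auto
qed

text \<open>A Pareto density. In the polar formula it is what remains of the auxiliary variable once
  the point of n-space, with norm \<open>a\<close>, is fixed.\<close>

lemma nn_integral_power_tail:
  assumes "n > 0" "a > 0"
  shows "(\<integral>\<^sup>+t. ennreal (real n * a ^ n / t ^ Suc n) * indicator {a..} t \<partial>lborel) = 1"
proof -
  have "(\<integral>\<^sup>+t. ennreal (real n * a ^ n / t ^ Suc n) * indicator {a..} t \<partial>lborel) = ennreal (0 - (- (a ^ n / a ^ n)))"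
  proof (rule nn_integral_FTC_atLeast[where F = "\<lambda>t. - (a ^ n / t ^ n)"])
    fix t assume "a \<le> t"
    then have t: "t > 0" using assms by simp
    have "t ^ n * t ^ n = t ^ (n - 1) * t ^ Suc n"
      using assms by (cases n) (simp_all add: mult_ac)
    then show "DERIV (\<lambda>t. - (a ^ n / t ^ n)) t :> real n * a ^ n / t ^ Suc n"
      using t by (auto intro!: derivative_eq_intros simp del: power_Suc simp: field_simps)
    show "0 \<le> real n * a ^ n / t ^ Suc n" using \<open>a \<le> t\<close> assms by simp
  next
    have "((\<lambda>t. - (a ^ n * inverse (t ^ n))) \<longlongrightarrow> - (a ^ n * 0)) at_top"
      using assms by (intro tendsto_intros tendsto_inverse_0_at_top filterlim_pow_at_top filterlim_ident)
    then show "((\<lambda>t. - (a ^ n / t ^ n)) \<longlongrightarrow> 0) at_top" by (simp add: divide_inverse)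
  qed measurable
  then show ?thesis using assms by simp
qed

text \<open>The factor 2 compensates the 1/2 in \<open>sphere_delta\<close>. The indicator lets the
  radial integral run over the whole line, on which affine substitutions are available.\<close>

definition radial_weight :: "nat \<Rightarrow> real \<Rightarrow> ennreal" where
  "radial_weight n r = ennreal (2 * r ^ (n - 1)) * indicator {0<..} r"

lemma radial_weight_measurable [measurable]: "radial_weight n \<in> borel_measurable borel"
  unfolding radial_weight_def by measurable

text \<open>
  The surface measure being defined through the unit ball, the formula follows from Tonelli and scaling: the radius
  of the ball point is traded for the radial variable.
\<close>

theorem nn_integral_polar:
  assumes n: "n > 0" and f [measurable]: "f \<in> borel_measurable (lebesgue_n n)"
  shows "(\<integral>\<^sup>+x. f x \<partial>lebesgue_n n) =
    (\<integral>\<^sup>+u. (\<integral>\<^sup>+r. radial_weight n r * f (scale_n n r u) \<partial>lborel) \<partial>sphere_delta n)"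
proof -
  let ?L = "lebesgue_n n"
  let ?B = "\<lambda>t. {x. 0 < norm_n n x \<and> norm_n n x \<le> t}"
  interpret L: sigma_finite_measure ?L by (rule sigma_finite_lebesgue_n)
  interpret pair_sigma_finite lborel ?L ..
  have "(\<integral>\<^sup>+u. (\<integral>\<^sup>+r. radial_weight n r * f (scale_n n r u) \<partial>lborel) \<partial>sphere_delta n) =
    ennreal (real n / 2) * (\<integral>\<^sup>+x. (\<integral>\<^sup>+r. radial_weight n r * f (scale_n n r (normalize_n n x)) \<partial>lborel) * indicator (?B 1) x \<partial>?L)"
    by (rule nn_integral_sphere_delta) measurable
  \<comment> \<open>Substitution r = |x| t: then r x/|x| = t x, and the weight together with the
    Jacobian yields |x|^n.\<close>
  also have "(\<integral>\<^sup>+x. (\<integral>\<^sup>+r. radial_weight n r * f (scale_n n r (normalize_n n x)) \<partial>lborel) * indicator (?B 1) x \<partial>?L) =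
    (\<integral>\<^sup>+x. (\<integral>\<^sup>+t. radial_weight n t * (ennreal (norm_n n x ^ n) * f (scale_n n t x) * indicator (?B 1) x) \<partial>lborel) \<partial>?L)"
  proof (rule nn_integral_cong)
    fix x assume x [measurable]: "x \<in> space ?L"
    show "(\<integral>\<^sup>+r. radial_weight n r * f (scale_n n r (normalize_n n x)) \<partial>lborel) * indicator (?B 1) x =
      (\<integral>\<^sup>+t. radial_weight n t * (ennreal (norm_n n x ^ n) * f (scale_n n t x) * indicator (?B 1) x) \<partial>lborel)"
    proof (cases "x \<in> ?B 1")
      case True
      define \<rho> where "\<rho> = norm_n n x"
      have \<rho>: "\<rho> > 0" using True by (simp add: \<rho>_def)
      have "(\<integral>\<^sup>+r. radial_weight n r * f (scale_n n r (normalize_n n x)) \<partial>lborel) =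
          \<bar>\<rho>\<bar> * (\<integral>\<^sup>+t. radial_weight n (0 + \<rho> * t) * f (scale_n n (0 + \<rho> * t) (normalize_n n x)) \<partial>lborel)"
        by (rule nn_integral_real_affine) (use \<rho> in auto)
      also have "\<dots> = (\<integral>\<^sup>+t. ennreal \<rho> * (radial_weight n (\<rho> * t) * f (scale_n n (\<rho> * t) (normalize_n n x))) \<partial>lborel)"
        using \<rho> by (subst nn_integral_cmult) auto
      also have "\<dots> = (\<integral>\<^sup>+t. radial_weight n t * (ennreal (\<rho> ^ n) * f (scale_n n t x)) \<partial>lborel)"
      proof (rule nn_integral_cong)
        fix t :: real
        have "scale_n n (\<rho> * t) (normalize_n n x) = scale_n n t x"
          using \<rho> by (simp add: normalize_n_eq_scale_n scale_n_scale_n \<rho>_def[symmetric] field_simps)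
        moreover have "ennreal \<rho> * radial_weight n (\<rho> * t) = radial_weight n t * ennreal (\<rho> ^ n)"
        proof (cases "t > 0")
          case True
          have "\<rho> * (2 * (\<rho> * t) ^ (n - 1)) = 2 * t ^ (n - 1) * \<rho> ^ n"
            using n by (cases n) (auto simp: power_mult_distrib)
          then show ?thesis using True \<rho> by (simp add: radial_weight_def ennreal_mult[symmetric])
        qed (use \<rho> in \<open>simp add: radial_weight_def zero_less_mult_iff\<close>)
        ultimately show "ennreal \<rho> * (radial_weight n (\<rho> * t) * f (scale_n n (\<rho> * t) (normalize_n n x))) =
            radial_weight n t * (ennreal (\<rho> ^ n) * f (scale_n n t x))"
          by (metis mult.assoc)
      qed
      finally show ?thesis using True by (simp add: \<rho>_def)
    qed simp
  qed
  also have "\<dots> = (\<integral>\<^sup>+t. (\<integral>\<^sup>+x. radial_weight n t * (ennreal (norm_n n x ^ n) * f (scale_n n t x) * indicator (?B 1) x) \<partial>?L) \<partial>lborel)"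
    by (rule Fubini') measurable
  \<comment> \<open>For fixed t, substitution y = t x. The ball constraint becomes |y| \<le> t,
    which after exchanging the integrals is a lower limit for t, so the t-integral is a Pareto
    integral.\<close>
  also have "\<dots> = (\<integral>\<^sup>+t. (\<integral>\<^sup>+y. ennreal (2 / t ^ Suc n) * indicator {0<..} t * (ennreal (norm_n n y ^ n) * f y * indicator (?B t) y) \<partial>?L) \<partial>lborel)"
  proof (rule nn_integral_cong)
    fix t :: real
    show "(\<integral>\<^sup>+x. radial_weight n t * (ennreal (norm_n n x ^ n) * f (scale_n n t x) * indicator (?B 1) x) \<partial>?L) =
      (\<integral>\<^sup>+y. ennreal (2 / t ^ Suc n) * indicator {0<..} t * (ennreal (norm_n n y ^ n) * f y * indicator (?B t) y) \<partial>?L)"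
    proof (cases "t > 0")
      case True
      let ?g = "\<lambda>y. ennreal (2 / t ^ Suc n) * indicator {0<..} t * (ennreal (norm_n n y ^ n) * f y * indicator (?B t) y)"
      have "(\<integral>\<^sup>+y. ?g y \<partial>?L) = ennreal (\<bar>t\<bar> ^ n) * (\<integral>\<^sup>+x. ?g (\<lambda>l\<in>{..<n}. 0 + t * x l) \<partial>?L)"
        by (rule nn_integral_lebesgue_n_affine) (use True in auto)
      also have "\<dots> = (\<integral>\<^sup>+x. ennreal (t ^ n) * ?g (scale_n n t x) \<partial>?L)"
        using True by (subst nn_integral_cmult) (auto simp: scale_n_def[symmetric])
      also have "\<dots> = (\<integral>\<^sup>+x. radial_weight n t * (ennreal (norm_n n x ^ n) * f (scale_n n t x) * indicator (?B 1) x) \<partial>?L)"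
      proof (rule nn_integral_cong)
        fix x
        have i: "indicator (?B t) (scale_n n t x) = (indicator (?B 1) x :: ennreal)"
          using True by (auto simp: indicator_def norm_n_scale_n zero_less_mult_iff mult_le_cancel_left1)
        have "t ^ n * (2 / t ^ Suc n * (t * norm_n n x) ^ n) = 2 * t ^ (n - 1) * norm_n n x ^ n"
          using True n by (cases n) (auto simp: power_mult_distrib field_simps)
        then have "ennreal (t ^ n) * (ennreal (2 / t ^ Suc n) * ennreal (norm_n n (scale_n n t x) ^ n)) = radial_weight n t * ennreal (norm_n n x ^ n)"
          using True norm_n_nonneg[of n x] by (simp add: radial_weight_def norm_n_scale_n ennreal_mult[symmetric])
        then show "ennreal (t ^ n) * ?g (scale_n n t x) = radial_weight n t * (ennreal (norm_n n x ^ n) * f (scale_n n t x) * indicator (?B 1) x)"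
          unfolding i using True by (simp add: mult.assoc[symmetric])
      qed
      finally show ?thesis by simp
    qed (simp add: radial_weight_def)
  qed
  also have "\<dots> = (\<integral>\<^sup>+y. (\<integral>\<^sup>+t. ennreal (2 / t ^ Suc n) * indicator {0<..} t * (ennreal (norm_n n y ^ n) * f y * indicator (?B t) y) \<partial>lborel) \<partial>?L)"
    by (rule Fubini'[symmetric]) measurable
  also have "ennreal (real n / 2) * \<dots> = (\<integral>\<^sup>+y. ennreal (real n / 2) * (\<integral>\<^sup>+t. ennreal (2 / t ^ Suc n) * indicator {0<..} t * (ennreal (norm_n n y ^ n) * f y * indicator (?B t) y) \<partial>lborel) \<partial>?L)"
    by (rule nn_integral_cmult[symmetric]) measurable
  also have "\<dots> = (\<integral>\<^sup>+y. f y \<partial>?L)"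
  proof (rule nn_integral_cong_AE)
    show "AE y in ?L. ennreal (real n / 2) * (\<integral>\<^sup>+t. ennreal (2 / t ^ Suc n) * indicator {0<..} t * (ennreal (norm_n n y ^ n) * f y * indicator (?B t) y) \<partial>lborel) = f y"
      using AE_lebesgue_n_norm_pos[OF n]
    proof (rule AE_mp, intro AE_I2 impI)
      fix y assume y: "y \<in> space ?L" "0 < norm_n n y"
      define a where "a = norm_n n y"
      have "ennreal (real n / 2) * (\<integral>\<^sup>+t. ennreal (2 / t ^ Suc n) * indicator {0<..} t * (ennreal (norm_n n y ^ n) * f y * indicator (?B t) y) \<partial>lborel)
        = (\<integral>\<^sup>+t. ennreal (real n / 2) * (ennreal (2 / t ^ Suc n) * indicator {0<..} t * (ennreal (norm_n n y ^ n) * f y * indicator (?B t) y)) \<partial>lborel)"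
        by (rule nn_integral_cmult[symmetric]) (use y in measurable)
      also have "\<dots> = (\<integral>\<^sup>+t. f y * (ennreal (real n * a ^ n / t ^ Suc n) * indicator {a..} t) \<partial>lborel)"
      proof (rule nn_integral_cong)
        fix t :: real
        show "ennreal (real n / 2) * (ennreal (2 / t ^ Suc n) * indicator {0<..} t * (ennreal (norm_n n y ^ n) * f y * indicator (?B t) y)) =
          f y * (ennreal (real n * a ^ n / t ^ Suc n) * indicator {a..} t)"
        proof (cases "a \<le> t")
          case True
          then have t: "t > 0" using y by (simp add: a_def)
          have "ennreal (real n / 2) * (ennreal (2 / t ^ Suc n) * ennreal (a ^ n)) = ennreal (real n * a ^ n / t ^ Suc n)"
            using t y by (simp add: ennreal_mult[symmetric] a_def)
          then show ?thesis using True t y by (simp add: a_def[symmetric]) (metis mult.assoc mult.commute)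
        qed (simp add: a_def)
      qed
      also have "\<dots> = f y"
        using nn_integral_power_tail[OF n, of a] y by (subst nn_integral_cmult) (auto simp: a_def)
      finally show "ennreal (real n / 2) * (\<integral>\<^sup>+t. ennreal (2 / t ^ Suc n) * indicator {0<..} t * (ennreal (norm_n n y ^ n) * f y * indicator (?B t) y) \<partial>lborel) = f y" .
    qed
  qed
  finally show ?thesis by simp
qed

section \<open>Polar coordinates for tuples of vectors\<close>

text \<open>The right-hand side is integration against the image \<open>?N\<close> of a weighted
  product measure. On a box its integrand is a product over \<open>i\<close>, so the one-factor
  formula applies to each index. All the radii stand in the inner integral, so that they can be
  varied while the directions stay fixed.\<close>

lemma nn_integral_PiM_disintegrate:
  fixes M :: "'a measure" and R :: "'b measure" and U :: "'c measure"
    and f :: "('i::finite \<Rightarrow> 'a) \<Rightarrow> ennreal"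
  assumes sf: "sigma_finite_measure M" "sigma_finite_measure R" "sigma_finite_measure U"
    and T: "case_prod T \<in> measurable (R \<Otimes>\<^sub>M U) M" and w [measurable]: "w \<in> borel_measurable R"
    and eq: "\<And>g. g \<in> borel_measurable M \<Longrightarrow>
        (\<integral>\<^sup>+x. g x \<partial>M) = (\<integral>\<^sup>+u. (\<integral>\<^sup>+r. w r * g (T r u) \<partial>R) \<partial>U)"
    and f: "f \<in> borel_measurable (\<Pi>\<^sub>M i\<in>UNIV. M)"
  shows "(\<integral>\<^sup>+x. f x \<partial>(\<Pi>\<^sub>M i\<in>UNIV. M)) =
    (\<integral>\<^sup>+u. (\<integral>\<^sup>+r. (\<Prod>i\<in>UNIV. w (r i)) * f (\<lambda>i. T (r i) (u i)) \<partial>(\<Pi>\<^sub>M i\<in>UNIV. R)) \<partial>(\<Pi>\<^sub>M i\<in>UNIV. U))"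
proof -
  let ?M = "\<Pi>\<^sub>M i\<in>(UNIV::'i set). M"
  let ?R = "\<Pi>\<^sub>M i\<in>(UNIV::'i set). R"
  let ?U = "\<Pi>\<^sub>M i\<in>(UNIV::'i set). U"
  interpret M: product_sigma_finite "\<lambda>_::'i. M" using sf by (simp add: product_sigma_finite_def)
  interpret R: product_sigma_finite "\<lambda>_::'i. R" using sf by (simp add: product_sigma_finite_def)
  interpret U: product_sigma_finite "\<lambda>_::'i. U" using sf by (simp add: product_sigma_finite_def)
  interpret PR: sigma_finite_measure ?R by (rule R.sigma_finite) simp
  let ?W = "\<lambda>(u, r). \<Prod>i\<in>UNIV. w (r i)"
  let ?T = "\<lambda>(u, r). \<lambda>i. T (r i) (u i)"
  have W [measurable]: "?W \<in> borel_measurable (?U \<Otimes>\<^sub>M ?R)"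
    by measurable
  have T' [measurable]: "?T \<in> measurable (?U \<Otimes>\<^sub>M ?R) ?M"
  proof (rule measurable_PiM_UNIV)
    fix i
    have "(\<lambda>p. (snd p i, fst p i)) \<in> measurable (?U \<Otimes>\<^sub>M ?R) (R \<Otimes>\<^sub>M U)"
      by (intro measurable_Pair measurable_compose[OF measurable_snd measurable_component_singleton]
          measurable_compose[OF measurable_fst measurable_component_singleton]) auto
    from measurable_compose[OF this T]
    show "(\<lambda>p. (case p of (u, r) \<Rightarrow> \<lambda>i. T (r i) (u i)) i) \<in> measurable (?U \<Otimes>\<^sub>M ?R) M"
      by (simp add: case_prod_unfold)
  qed
  let ?N = "distr (density (?U \<Otimes>\<^sub>M ?R) ?W) ?M ?T"
  have N: "(\<integral>\<^sup>+x. g x \<partial>?N) = (\<integral>\<^sup>+u. (\<integral>\<^sup>+r. (\<Prod>i\<in>UNIV. w (r i)) * g (\<lambda>i. T (r i) (u i)) \<partial>?R) \<partial>?U)"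
    if [measurable]: "g \<in> borel_measurable ?M" for g
    by (simp add: nn_integral_distr nn_integral_density PR.nn_integral_fst[symmetric])
  have "?N = ?M"
  proof (rule M.PiM_eqI)
    fix A :: "'i \<Rightarrow> 'a set" assume A: "\<And>i. i \<in> UNIV \<Longrightarrow> A i \<in> sets M"
    then have [measurable]: "A i \<in> sets M" for i by simp
    have PA: "PiE UNIV A \<in> sets ?M" using A by (intro sets_PiM_I_finite) auto
    let ?g = "\<lambda>i r u. w r * indicator (A i) (T r u) :: ennreal"
    have mg: "case_prod (?g i) \<in> borel_measurable (R \<Otimes>\<^sub>M U)" for i
      using T by measurable
    have g2: "(\<lambda>r. ?g i r u) \<in> borel_measurable R" if "u \<in> space U" for i u
      using measurable_compose[OF measurable_Pair2'[OF that] mg[of i]] by simp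
    have g3: "(\<lambda>u. \<integral>\<^sup>+r. ?g i r u \<partial>R) \<in> borel_measurable U" for i
    proof (rule sigma_finite_measure.borel_measurable_nn_integral[OF sf(2)])
      have "(\<lambda>(u, r). (r, u)) \<in> measurable (U \<Otimes>\<^sub>M R) (R \<Otimes>\<^sub>M U)" by measurable
      from measurable_compose[OF this mg[of i]]
      show "(\<lambda>(u, r). ?g i r u) \<in> borel_measurable (U \<Otimes>\<^sub>M R)" by (simp add: case_prod_unfold)
    qed
    have "emeasure ?N (PiE UNIV A) = (\<integral>\<^sup>+x. indicator (PiE UNIV A) x \<partial>?N)"
      using PA by simp
    also have "\<dots> = (\<integral>\<^sup>+u. (\<integral>\<^sup>+r. (\<Prod>i\<in>UNIV. w (r i)) * indicator (PiE UNIV A) (\<lambda>i. T (r i) (u i)) \<partial>?R) \<partial>?U)"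
      by (rule N) (use PA in simp)
    also have "\<dots> = (\<integral>\<^sup>+u. (\<integral>\<^sup>+r. (\<Prod>i\<in>UNIV. ?g i (r i) (u i)) \<partial>?R) \<partial>?U)"
    proof -
      have "indicator (PiE UNIV A) x = (\<Prod>i\<in>UNIV. indicator (A i) (x i) :: ennreal)" for x :: "'i \<Rightarrow> 'a"
        by (auto simp: indicator_def PiE_iff)
      then show ?thesis by (simp add: prod.distrib)
    qed
    also have "\<dots> = (\<integral>\<^sup>+u. (\<Prod>i\<in>UNIV. \<integral>\<^sup>+r. ?g i r (u i) \<partial>R) \<partial>?U)"
    proof (rule nn_integral_cong)
      fix u assume "u \<in> space ?U"
      then have "u i \<in> space U" for i by (auto simp: space_PiM)
      then show "(\<integral>\<^sup>+r. (\<Prod>i\<in>UNIV. ?g i (r i) (u i)) \<partial>?R) = (\<Prod>i\<in>UNIV. \<integral>\<^sup>+r. ?g i r (u i) \<partial>R)"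
        by (intro R.product_nn_integral_prod g2) auto
    qed
    also have "\<dots> = (\<Prod>i\<in>UNIV. \<integral>\<^sup>+u. (\<integral>\<^sup>+r. ?g i r u \<partial>R) \<partial>U)"
      by (intro U.product_nn_integral_prod g3) auto
    also have "\<dots> = (\<Prod>i\<in>UNIV. emeasure M (A i))"
      by (intro prod.cong refl) (simp add: eq[symmetric])
    finally show "emeasure ?N (PiE UNIV A) = (\<Prod>i\<in>UNIV. emeasure M (A i))" .
  qed auto
  then show ?thesis using N[OF f] by simp
qed

abbreviation spheres_delta :: "nat \<Rightarrow> ('k \<Rightarrow> nat \<Rightarrow> real) measure" where
  "spheres_delta n \<equiv> \<Pi>\<^sub>M i\<in>(UNIV :: 'k set). sphere_delta n"

lemma nn_integral_polar_kn:
  fixes f :: "('k::finite \<Rightarrow> nat \<Rightarrow> real) \<Rightarrow> ennreal"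
  assumes n: "n > 0" and f: "f \<in> borel_measurable (lebesgue_kn n)"
  shows "(\<integral>\<^sup>+x. f x \<partial>lebesgue_kn n) =
    (\<integral>\<^sup>+u. (\<integral>\<^sup>+r. (\<Prod>i\<in>UNIV. radial_weight n (r i)) * f (\<lambda>i. scale_n n (r i) (u i))
      \<partial>(\<Pi>\<^sub>M i\<in>UNIV. lborel)) \<partial>spheres_delta n)"
proof (rule nn_integral_PiM_disintegrate[OF sigma_finite_lebesgue_n sigma_finite_lborel _ _ _ nn_integral_polar[OF n] f])
  interpret finite_measure "sphere_delta n" by (rule finite_measure_sphere_delta)
  show "sigma_finite_measure (sphere_delta n)" ..
  have "snd \<in> measurable (lborel \<Otimes>\<^sub>M sphere_delta n) (lebesgue_n n)"
    using measurable_snd[of lborel "sphere_delta n"]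
    by (simp add: measurable_cong_sets[OF refl sets_sphere_delta])
  then show "case_prod (scale_n n) \<in> measurable (lborel \<Otimes>\<^sub>M sphere_delta n) (lebesgue_n n)"
    unfolding case_prod_unfold by (intro scale_n_measurable) auto
qed (simp add: radial_weight_measurable)

text \<open>An exception in coordinate \<open>j\<close> lies in a box with one null side, and there
  are finitely many coordinates.\<close>

lemma AE_PiM_all:
  fixes M :: "'a measure"
  assumes M: "sigma_finite_measure M" and P: "AE x in M. P x"
  shows "AE x in (\<Pi>\<^sub>M i\<in>(UNIV::'i::finite set). M). \<forall>i. P (x i)"
proof -
  interpret product_sigma_finite "\<lambda>_::'i. M" using M by (simp add: product_sigma_finite_def)
  obtain N where N: "N \<in> null_sets M" "{x \<in> space M. \<not> P x} \<subseteq> N" using P by (auto elim: AE_E3 simp: eventually_ae_filter)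
  have "AE x in (\<Pi>\<^sub>M i\<in>(UNIV::'i set). M). P (x j)" for j
  proof (rule AE_I')
    let ?B = "PiE UNIV (\<lambda>i::'i. if i = j then N else space M)"
    have "emeasure (\<Pi>\<^sub>M i\<in>(UNIV::'i set). M) ?B = (\<Prod>i\<in>UNIV. emeasure M (if i = j then N else space M))"
      using N by (intro emeasure_PiM) auto
    also have "\<dots> = 0" using N by (intro prod_zero) (auto intro!: exI[of _ j])
    finally show "?B \<in> null_sets (\<Pi>\<^sub>M i\<in>(UNIV::'i set). M)"
      using N by (auto simp: null_sets_def intro!: sets_PiM_I_finite)
    show "{x \<in> space (\<Pi>\<^sub>M i\<in>(UNIV::'i set). M). \<not> P (x j)} \<subseteq> ?B"
      using N by (auto simp: space_PiM PiE_iff)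
  qed
  then show ?thesis by (simp add: AE_all_countable)
qed

lemma AE_spheres_delta_norm: "AE u in spheres_delta n. \<forall>i::'k::finite. norm_n n (u i) = 1"
proof -
  interpret finite_measure "sphere_delta n" by (rule finite_measure_sphere_delta)
  show ?thesis by (intro AE_PiM_all AE_sphere_delta_norm) unfold_locales
qed

subsection \<open>Gaussian covariances\<close>

definition gauss_moment :: "nat \<Rightarrow> real" where
  "gauss_moment e = (\<integral>t. std_normal_density t * t ^ e \<partial>lborel)"

lemma gauss_moment_values:
  "gauss_moment 0 = 1" "gauss_moment (Suc 0) = 0" "gauss_moment 2 = 1" "gauss_moment 4 = 3"
  using integral_std_normal_moment_even[of 0] integral_std_normal_moment_odd[of 0]
    integral_std_normal_moment_even[of 1] integral_std_normal_moment_even[of 2]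
  by (simp_all add: gauss_moment_def fact_numeral)

definition gauss_density :: "nat \<Rightarrow> ('k::finite \<Rightarrow> nat \<Rightarrow> real) \<Rightarrow> real" where
  "gauss_density n y = (\<Prod>i\<in>UNIV. \<Prod>l<n. std_normal_density (y i l))"

lemma gauss_density_nonneg: "0 \<le> gauss_density n y"
  by (simp add: gauss_density_def prod_nonneg)

text \<open>All entries are independent standard normal variables, so any mixed moment is read off
  from its matrix of exponents.\<close>

lemma gauss_density_monomial:
  fixes e :: "'k::finite \<Rightarrow> nat \<Rightarrow> nat"
  shows "has_bochner_integral (lebesgue_kn n)
    (\<lambda>y. gauss_density n y * (\<Prod>i\<in>UNIV. \<Prod>l<n. y i l ^ e i l)) (\<Prod>i\<in>UNIV. \<Prod>l<n. gauss_moment (e i l))"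
proof -
  interpret L: product_sigma_finite "\<lambda>_::nat. lborel :: real measure" by (rule product_sigma_finite_lborel)
  interpret K: product_sigma_finite "\<lambda>_::'k. lebesgue_n n" by (rule product_sigma_finite_lebesgue_n)
  let ?f = "\<lambda>i y. \<Prod>l<n. std_normal_density (y l) * y l ^ e i l"
  have i1: "integrable (lebesgue_n n) (?f i)" for i
    by (rule L.product_integrable_prod) (auto intro: integrable_std_normal_moment)
  have v1: "integral\<^sup>L (lebesgue_n n) (?f i) = (\<Prod>l<n. gauss_moment (e i l))" for i
    unfolding gauss_moment_def
    by (rule L.product_integral_prod) (auto intro: integrable_std_normal_moment)
  have i2: "integrable (lebesgue_kn n) (\<lambda>y. \<Prod>i\<in>UNIV. ?f i (y i))"
    by (rule K.product_integrable_prod) (auto intro: i1)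
  have v2: "integral\<^sup>L (lebesgue_kn n) (\<lambda>y. \<Prod>i\<in>UNIV. ?f i (y i)) = (\<Prod>i\<in>UNIV. \<Prod>l<n. gauss_moment (e i l))"
    unfolding v1[symmetric] by (rule K.product_integral_prod) (auto intro: i1)
  show ?thesis
    using i2 v2 by (simp add: has_bochner_integral_iff gauss_density_def prod.distrib)
qed

lemma nn_integral_gauss_density: "(\<integral>\<^sup>+y. ennreal (gauss_density n (y :: 'k::finite \<Rightarrow> nat \<Rightarrow> real)) \<partial>lebesgue_kn n) = 1"
proof -
  have "has_bochner_integral (lebesgue_kn n) (gauss_density n :: ('k \<Rightarrow> nat \<Rightarrow> real) \<Rightarrow> real) 1"
    using gauss_density_monomial[of n "\<lambda>_ _. 0"] by (simp add: gauss_moment_values)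
  then show ?thesis
    by (simp add: has_bochner_integral_iff nn_integral_eq_integral gauss_density_nonneg)
qed

lemma prod_power_of_bool:
  fixes z :: "'i \<Rightarrow> 'a::comm_monoid_mult"
  assumes "finite I" "a \<in> I"
  shows "(\<Prod>i\<in>I. z i ^ of_bool (i = a)) = z a"
proof -
  have "(\<Prod>i\<in>I. z i ^ of_bool (i = a)) = (\<Prod>i\<in>I. if i = a then z i else 1)"
    by (intro prod.cong) auto
  then show ?thesis using assms by simp
qed

text \<open>A variance: the centred inner product is a sum of \<open>n\<close> independent centred
  terms, each of variance \<open>1 + \<delta>\<close>, that is 2 on the diagonal and 1 off
  it.\<close>

lemma gauss_covariance_second_moment:
  fixes a b :: "'k::finite"
  defines "\<delta> \<equiv> if a = b then 1 else (0::real)"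
  shows "(\<integral>\<^sup>+y. ennreal (gauss_density n y * (inner_n n (y a) (y b) - n * \<delta>)\<^sup>2) \<partial>lebesgue_kn n) \<le> ennreal (2 * real n)"
proof -
  let ?L = "lebesgue_kn n :: ('k \<Rightarrow> nat \<Rightarrow> real) measure"
  have mono2: "has_bochner_integral ?L (\<lambda>y. gauss_density n y * (y a l * y b l * (y a m * y b m)))
      (if a = b then if l = m then 3 else 1 else if l = m then 1 else 0)" if "l < n" "m < n" for l m
  proof -
    \<comment> \<open>The fourth-order monomial has exponent matrix \<open>?q j * ?p i\<close>. Its
      entries are a single 4 if both index pairs coincide, two entries 2 if exactly one pair does,
      and four entries 1 otherwise, whence the values 3, 1 and 0.\<close>
    let ?p = "\<lambda>i. of_bool (i = a) + of_bool (i = b) :: nat"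
    let ?q = "\<lambda>j. of_bool (j = l) + of_bool (j = m) :: nat"
    have "(\<Prod>i\<in>UNIV. \<Prod>j<n. y i j ^ (?q j * ?p i)) = y a l * y b l * (y a m * y b m)" for y :: "'k \<Rightarrow> nat \<Rightarrow> real"
      using that
      by (simp add: power_mult prod_power_distrib[symmetric] power_add prod.distrib prod_power_of_bool mult_ac)
    moreover have "(\<Prod>i\<in>UNIV. \<Prod>j<n. gauss_moment (?q j * ?p i)) =
        (if a = b then if l = m then 3 else 1 else if l = m then 1 else 0)"
    proof (cases "a = b \<and> l = m")
      case True
      then have "gauss_moment (?q j * ?p i) = (if i = a then if j = l then 3 else 1 else 1)" for i j
        by (auto simp: gauss_moment_values numeral_2_eq_2[symmetric])
      moreover have "(\<Prod>j<n. if i = a then if j = l then 3 else 1 else 1) = (if i = a then 3 else 1 :: real)" for i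
        using \<open>l < n\<close> by (cases "i = a") auto
      ultimately show ?thesis using True by simp
    next
      case False
      have "gauss_moment (?q j * ?p i) = 1" if "a = b \<or> l = m" for i j
        using that False by (auto simp: gauss_moment_values numeral_2_eq_2[symmetric])
      moreover have "(\<Prod>i\<in>UNIV. \<Prod>j<n. gauss_moment (?q j * ?p i)) = 0" if "\<not> (a = b \<or> l = m)"
        using that \<open>l < n\<close> by (intro prod_zero bexI[of _ a] bexI[of _ l]) (auto simp: gauss_moment_values)
      ultimately show ?thesis using False by (cases "a = b \<or> l = m") auto
    qed
    ultimately show ?thesis using gauss_density_monomial[of n "\<lambda>i j. ?q j * ?p i"] by (simp only:)
  qed
  \<comment> \<open>Second-order moments enter the expansion only for \<open>a = b\<close>, because
    the centring constant \<open>\<delta>\<close> is 0 otherwise.\<close>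
  have mono1: "has_bochner_integral ?L (\<lambda>y. gauss_density n y * (y a l * y b l)) 1" if "a = b" "l < n" for l
  proof -
    let ?p = "\<lambda>i. 2 * of_bool (i = a) :: nat"
    let ?q = "\<lambda>j. of_bool (j = l) :: nat"
    have "(\<Prod>i\<in>UNIV. \<Prod>j<n. y i j ^ (?q j * ?p i)) = y a l * y b l" for y :: "'k \<Rightarrow> nat \<Rightarrow> real"
    proof -
      have "(\<Prod>i\<in>UNIV. \<Prod>j<n. y i j ^ (?q j * ?p i)) = (\<Prod>i\<in>UNIV. (y i l ^ 2) ^ of_bool (i = a))"
        using that by (simp add: power_mult prod_power_distrib[symmetric] prod_power_of_bool)
      then show ?thesis using that by (simp add: prod_power_of_bool power2_eq_square)
    qed
    moreover have "(\<Prod>i\<in>UNIV. \<Prod>j<n. gauss_moment (?q j * ?p i)) = 1"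
      by (intro prod.neutral ballI) (auto simp: gauss_moment_values numeral_2_eq_2[symmetric])
    ultimately show ?thesis using gauss_density_monomial[of n "\<lambda>i j. ?q j * ?p i"] by (simp only:)
  qed
  have mono0: "has_bochner_integral ?L (gauss_density n) 1"
    using gauss_density_monomial[of n "\<lambda>_ _. 0"] by (simp add: gauss_moment_values)
  let ?Z = "\<lambda>y l m. gauss_density n y * ((y a l * y b l - \<delta>) * (y a m * y b m - \<delta>))"
  have Z: "has_bochner_integral ?L (\<lambda>y. ?Z y l m) (if l = m then 1 + \<delta> else 0)" if "l < n" "m < n" for l m
  proof (cases "a = b")
    case True
    have "has_bochner_integral ?L (\<lambda>y. gauss_density n y * (y a l * y b l * (y a m * y b m))
       - gauss_density n y * (y a l * y b l) - gauss_density n y * (y a m * y b m) + gauss_density n y)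
       ((if l = m then 3 else 1) - 1 - 1 + 1)"
      using that True mono2[OF that]
      by (intro has_bochner_integral_add has_bochner_integral_diff mono1 mono0) auto
    moreover have "?Z y l m = gauss_density n y * (y a l * y b l * (y a m * y b m))
       - gauss_density n y * (y a l * y b l) - gauss_density n y * (y a m * y b m) + gauss_density n y" for y
      using True by (simp add: \<delta>_def algebra_simps)
    moreover have "(if l = m then 3 else 1) - 1 - 1 + 1 = (if l = m then 1 + \<delta> else 0)"
      using True by (simp add: \<delta>_def)
    ultimately show ?thesis by (simp only:)
  next
    case False
    then show ?thesis using mono2[OF that] by (cases "l = m") (simp_all add: \<delta>_def)
  qed
  have "has_bochner_integral ?L (\<lambda>y. \<Sum>l<n. \<Sum>m<n. ?Z y l m) (\<Sum>l<n. \<Sum>m<n. if l = m then 1 + \<delta> else 0)"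
    by (intro has_bochner_integral_sum Z) auto
  moreover have "(\<Sum>l<n. \<Sum>m<n. ?Z y l m) = gauss_density n y * (inner_n n (y a) (y b) - n * \<delta>)\<^sup>2" for y
  proof -
    have "inner_n n (y a) (y b) - n * \<delta> = (\<Sum>l<n. y a l * y b l - \<delta>)"
      by (simp add: inner_n_def sum_subtractf)
    then show ?thesis unfolding power2_eq_square by (simp only: sum_product) (simp add: sum_distrib_left)
  qed
  moreover have "(\<Sum>l<n. \<Sum>m<n. if l = m then 1 + \<delta> else 0) = n * (1 + \<delta>)" by simp
  ultimately have "has_bochner_integral ?L (\<lambda>y. gauss_density n y * (inner_n n (y a) (y b) - n * \<delta>)\<^sup>2) (n * (1 + \<delta>))"
    by (simp only:)
  then have "(\<integral>\<^sup>+y. ennreal (gauss_density n y * (inner_n n (y a) (y b) - n * \<delta>)\<^sup>2) \<partial>?L) = ennreal (n * (1 + \<delta>))"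
    by (simp add: has_bochner_integral_iff nn_integral_eq_integral gauss_density_nonneg)
  also have "\<dots> \<le> ennreal (2 * real n)" by (intro ennreal_leI) (simp add: \<delta>_def)
  finally show ?thesis .
qed

text \<open>Chebyshev with a union bound over the k^2 pairs, written pointwise: off the good set
  some term \<open>?c * (?Z a b y)\<^sup>2\<close> is at least 1. The threshold is chosen so that
  each pair costs at most 2n / (4 k^2 n), hence all together at most 1/2.\<close>

lemma gauss_covariance_concentration:
  fixes n :: nat
  assumes n: "n > 0"
  shows "ennreal (1/2) \<le> (\<integral>\<^sup>+y. ennreal (gauss_density n y) *
    indicator {y. \<forall>a b. \<bar>inner_n n (y a) (y b) - real n * (if a = b then 1 else 0)\<bar> \<le> 2 * CARD('k) * sqrt n} y
    \<partial>(lebesgue_kn n :: ('k::finite \<Rightarrow> nat \<Rightarrow> real) measure))"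
proof -
  let ?L = "lebesgue_kn n :: ('k \<Rightarrow> nat \<Rightarrow> real) measure"
  let ?Z = "\<lambda>a b y. inner_n n (y a) (y b) - real n * (if a = b then 1 else 0)"
  let ?k = "real CARD('k)"
  let ?G = "{y :: 'k \<Rightarrow> nat \<Rightarrow> real. \<forall>a b. \<bar>?Z a b y\<bar> \<le> 2 * ?k * sqrt n}"
  let ?c = "1 / (4 * ?k\<^sup>2 * n)"
  have comp [measurable]: "(\<lambda>y. y a) \<in> measurable ?L (lebesgue_n n)" for a by simp
  have G [measurable]: "gauss_density n \<in> borel_measurable ?L"
    unfolding gauss_density_def
    by (intro borel_measurable_prod measurable_compose[OF measurable_PiM_entry]) auto
  have Gs [measurable]: "Measurable.pred ?L (\<lambda>y. y \<in> ?G)" by measurable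
  have k: "?k > 0" by simp
  have "1 = (\<integral>\<^sup>+y. ennreal (gauss_density n y) \<partial>?L)" by (rule nn_integral_gauss_density[symmetric])
  also have "\<dots> \<le> (\<integral>\<^sup>+y. ennreal (gauss_density n y) * indicator ?G y +
      (\<Sum>a\<in>UNIV. \<Sum>b\<in>UNIV. ennreal ?c * ennreal (gauss_density n y * (?Z a b y)\<^sup>2)) \<partial>?L)"
  proof (rule nn_integral_mono)
    fix y :: "'k \<Rightarrow> nat \<Rightarrow> real"
    show "ennreal (gauss_density n y) \<le> ennreal (gauss_density n y) * indicator ?G y +
      (\<Sum>a\<in>UNIV. \<Sum>b\<in>UNIV. ennreal ?c * ennreal (gauss_density n y * (?Z a b y)\<^sup>2))"
    proof (cases "y \<in> ?G")
      case False
      then obtain a b where ab: "\<bar>?Z a b y\<bar> > 2 * ?k * sqrt n" by (auto simp: not_le)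
      have "(2 * ?k * sqrt n)\<^sup>2 \<le> (\<bar>?Z a b y\<bar>)\<^sup>2" using ab by (intro power_mono) auto
      then have "1 \<le> ?c * (?Z a b y)\<^sup>2" using n k by (simp add: power_mult_distrib field_simps)
      then have "gauss_density n y * 1 \<le> gauss_density n y * (?c * (?Z a b y)\<^sup>2)"
        by (intro mult_left_mono gauss_density_nonneg)
      then have "ennreal (gauss_density n y) \<le> ennreal ?c * ennreal (gauss_density n y * (?Z a b y)\<^sup>2)"
        by (subst ennreal_mult[symmetric]) (auto intro!: ennreal_leI mult_nonneg_nonneg gauss_density_nonneg simp: mult_ac)
      also have "\<dots> \<le> (\<Sum>b\<in>UNIV. ennreal ?c * ennreal (gauss_density n y * (?Z a b y)\<^sup>2))"
        by (rule member_le_sum[of b UNIV "\<lambda>b. ennreal ?c * ennreal (gauss_density n y * (?Z a b y)\<^sup>2)"]) auto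
      also have "\<dots> \<le> (\<Sum>a\<in>UNIV. \<Sum>b\<in>UNIV. ennreal ?c * ennreal (gauss_density n y * (?Z a b y)\<^sup>2))"
        by (rule member_le_sum[of a UNIV "\<lambda>a. \<Sum>b\<in>UNIV. ennreal ?c * ennreal (gauss_density n y * (?Z a b y)\<^sup>2)"]) auto
      finally show ?thesis using False by simp
    qed simp
  qed
  also have "\<dots> = (\<integral>\<^sup>+y. ennreal (gauss_density n y) * indicator ?G y \<partial>?L) +
      (\<Sum>a\<in>UNIV. \<Sum>b\<in>UNIV. ennreal ?c * (\<integral>\<^sup>+y. ennreal (gauss_density n y * (?Z a b y)\<^sup>2) \<partial>?L))"
    by (subst nn_integral_add) (auto simp: nn_integral_sum nn_integral_cmult)
  also have "\<dots> \<le> (\<integral>\<^sup>+y. ennreal (gauss_density n y) * indicator ?G y \<partial>?L) +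
      (\<Sum>a\<in>(UNIV::'k set). \<Sum>b\<in>(UNIV::'k set). ennreal ?c * ennreal (2 * real n))"
    by (intro add_left_mono sum_mono mult_left_mono gauss_covariance_second_moment) auto
  also have "(\<Sum>a\<in>(UNIV::'k set). \<Sum>b\<in>(UNIV::'k set). ennreal ?c * ennreal (2 * real n)) = ennreal (1/2)"
  proof -
    have "ennreal ?c * ennreal (2 * real n) = ennreal (?c * (2 * real n))" by (rule ennreal_mult[symmetric]) auto
    then have "(\<Sum>a\<in>(UNIV::'k set). \<Sum>b\<in>(UNIV::'k set). ennreal ?c * ennreal (2 * real n)) =
        ennreal ?k * (ennreal ?k * ennreal (?c * (2 * real n)))"
      by (simp only: sum_constant ennreal_of_nat_eq_real_of_nat)
    also have "\<dots> = ennreal (?k * (?k * (?c * (2 * real n))))"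
      by (simp only: ennreal_mult[symmetric] of_nat_0_le_iff mult_nonneg_nonneg zero_le_divide_1_iff zero_le_power2 zero_le_numeral)
    also have "?k * (?k * (?c * (2 * real n))) = 1/2"
      using n k by (simp add: power2_eq_square)
    finally show ?thesis .
  qed
  finally have *: "1 \<le> (\<integral>\<^sup>+y. ennreal (gauss_density n y) * indicator ?G y \<partial>?L) + ennreal (1/2)" .
  have "ennreal (1/2) + ennreal (1/2) = 1" by (subst ennreal_plus[symmetric]) auto
  with * have "ennreal (1/2) + ennreal (1/2) \<le> ennreal (1/2) + (\<integral>\<^sup>+y. ennreal (gauss_density n y) * indicator ?G y \<partial>?L)"
    by (simp only: add.commute)
  then show ?thesis unfolding ennreal_add_left_cancel_le by simp
qed

section \<open>The polar integrand as a function of the radii\<close>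

definition gram_form :: "nat \<Rightarrow> real^'k^'k \<Rightarrow> ('k \<Rightarrow> nat \<Rightarrow> real) \<Rightarrow> real" where
  "gram_form n P x = (\<Sum>i\<in>UNIV. \<Sum>j\<in>UNIV. inner_n n (x i) (x j) * P $ i $ j)"

lemma inner_n_commute: "inner_n n x y = inner_n n y x"
  by (simp add: inner_n_def mult.commute)

lemma inner_n_le_1:
  assumes "norm_n n x = 1" "norm_n n y = 1"
  shows "\<bar>inner_n n x y\<bar> \<le> 1"
proof -
  have 1: "inner_n n x x = 1" "inner_n n y y = 1" using assms by (simp_all add: norm_n_def)
  have "inner_n n (\<lambda>l. x l + c * y l) (\<lambda>l. x l + c * y l) = inner_n n x x + 2 * c * inner_n n x y + c * c * inner_n n y y" for c
    by (simp add: inner_n_def algebra_simps sum.distrib sum_distrib_left)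
  from this[of 1] this[of "-1"] 1 show ?thesis
    using inner_n_self_nonneg[of n "\<lambda>l. x l + 1 * y l"] inner_n_self_nonneg[of n "\<lambda>l. x l + (-1) * y l"] by auto
qed

text \<open>The logarithm of the ratio between the polar integrand at radii \<open>r\<close> and at
  radii 1, for directions with Gram matrix \<open>G\<close>; \<open>radial_weight_gram_form\<close>
  makes this precise.\<close>

definition radial_exponent :: "nat \<Rightarrow> real^'k^'k \<Rightarrow> ('k \<Rightarrow> 'k \<Rightarrow> real) \<Rightarrow> ('k \<Rightarrow> real) \<Rightarrow> real" where
  "radial_exponent n P G r = (\<Sum>i\<in>UNIV. (real n - 1) * ln (r i)) -
     n / 2 * (\<Sum>i\<in>UNIV. \<Sum>j\<in>UNIV. P $ i $ j * (r i * r j - 1) * G i j)"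

text \<open>
  The first-order coefficient of the exponent in \<open>r - 1\<close> is \<open>n (1 - P G)\<^sub>i\<^sub>i\<close>; the rest is bounded on the
  scale \<open>1/sqrt n\<close>.
\<close>

lemma radial_exponent_estimate:
  fixes P :: "real^'k^'k" and r :: "'k \<Rightarrow> real" and m :: real
  defines "b \<equiv> \<lambda>G i. 1 - (\<Sum>j\<in>UNIV. P $ i $ j * G i j)"
  assumes n: "n > 0" and P: "transpose P = P" and G: "\<And>i j. G i j = G j i" "\<And>i j. \<bar>G i j\<bar> \<le> 1"
    and m: "2 * m \<le> sqrt n" and r: "\<And>i. \<bar>r i - 1\<bar> \<le> m / sqrt n"
  shows "\<bar>radial_exponent n P G r - n * (\<Sum>i\<in>UNIV. (r i - 1) * b G i)\<bar> \<le>
    CARD('k) * (2 * m\<^sup>2 + 1) + (\<Sum>i\<in>UNIV. \<Sum>j\<in>UNIV. \<bar>P $ i $ j\<bar>) * m\<^sup>2 / 2"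
proof -
  define s where "s i = r i - 1" for i
  define \<epsilon> where "\<epsilon> = m / sqrt n"
  have \<epsilon>: "0 \<le> \<epsilon>" using r[of undefined] by (simp add: \<epsilon>_def)
  have eh: "\<epsilon> \<le> 1/2" using m n by (simp add: \<epsilon>_def field_simps)
  have ne: "n * \<epsilon>\<^sup>2 = m\<^sup>2" using n by (simp add: \<epsilon>_def power_divide)
  have s: "\<bar>s i\<bar> \<le> \<epsilon>" for i using r by (simp add: s_def \<epsilon>_def)
  have Ps: "P $ i $ j = P $ j $ i" for i j using P by (metis transpose_def vec_lambda_beta)
  let ?Q = "\<Sum>i\<in>UNIV. \<Sum>j\<in>UNIV. P $ i $ j * s i * s j * G i j"
  \<comment> \<open>Symmetry of \<open>P\<close> and \<open>G\<close> identifies the two first-order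
    sums; the resulting factor 2 turns the prefactor n/2 into n.\<close>
  have sw: "(\<Sum>i\<in>UNIV. \<Sum>j\<in>UNIV. P $ i $ j * s j * G i j) = (\<Sum>i\<in>UNIV. \<Sum>j\<in>UNIV. P $ i $ j * s i * G i j)"
    by (subst sum.swap) (simp add: Ps G(1))
  have "(\<Sum>i\<in>UNIV. \<Sum>j\<in>UNIV. P $ i $ j * (r i * r j - 1) * G i j) =
      (\<Sum>i\<in>UNIV. \<Sum>j\<in>UNIV. P $ i $ j * s i * G i j + P $ i $ j * s j * G i j + P $ i $ j * s i * s j * G i j)"
    by (intro sum.cong refl) (simp add: s_def algebra_simps)
  also have "\<dots> = 2 * (\<Sum>i\<in>UNIV. \<Sum>j\<in>UNIV. P $ i $ j * s i * G i j) + ?Q"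
    by (simp add: sum.distrib sw)
  finally have e1: "(\<Sum>i\<in>UNIV. \<Sum>j\<in>UNIV. P $ i $ j * (r i * r j - 1) * G i j) =
      2 * (\<Sum>i\<in>UNIV. \<Sum>j\<in>UNIV. P $ i $ j * s i * G i j) + ?Q" .
  have e2: "(\<Sum>i\<in>UNIV. s i * b G i) = sum s UNIV - (\<Sum>i\<in>UNIV. \<Sum>j\<in>UNIV. P $ i $ j * s i * G i j)"
    by (simp add: b_def right_diff_distrib sum_subtractf sum_distrib_left mult_ac)
  have e3: "(\<Sum>i\<in>UNIV. (real n - 1) * ln (1 + s i) - n * s i) = (\<Sum>i\<in>UNIV. (real n - 1) * ln (r i)) - n * sum s UNIV"
    by (simp add: sum_subtractf sum_distrib_left) (simp add: s_def)
  have e4: "l - n / 2 * (2 * x + q) - n * (t - x) = (l - n * t) - n / 2 * q" for l x q t :: real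
    by (simp add: algebra_simps)
  have eq: "radial_exponent n P G r - n * (\<Sum>i\<in>UNIV. s i * b G i) =
      (\<Sum>i\<in>UNIV. (real n - 1) * ln (1 + s i) - n * s i) - n / 2 * ?Q"
    unfolding radial_exponent_def e1 e2 e3 by (rule e4)
  \<comment> \<open>Splitting off the linear part leaves
    \<open>(real n - 1) * (ln (1 + s i) - s i) - s i\<close>. The last term stems from the power n -
    1 instead of n; it is at most 1/2 and is absorbed by the \<open>+ 1\<close>.\<close>
  have 1: "\<bar>(real n - 1) * ln (1 + s i) - n * s i\<bar> \<le> 2 * m\<^sup>2 + 1" for i
  proof -
    have "\<bar>ln (1 + s i) - s i\<bar> \<le> 2 * (s i)\<^sup>2"
      using s[of i] eh by (intro abs_ln_one_plus_x_minus_x_bound) linarith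
    also have "(s i)\<^sup>2 \<le> \<epsilon>\<^sup>2" using s[of i] by (metis abs_le_square_iff abs_of_nonneg \<epsilon>)
    finally have "\<bar>(real n - 1) * (ln (1 + s i) - s i)\<bar> \<le> real n * (2 * \<epsilon>\<^sup>2)"
      unfolding abs_mult using n by (intro mult_mono) auto
    also have "\<dots> = 2 * m\<^sup>2" using ne by simp
    finally have "\<bar>(real n - 1) * (ln (1 + s i) - s i) - s i\<bar> \<le> 2 * m\<^sup>2 + 1"
      using s[of i] eh by linarith
    then show ?thesis by (simp add: algebra_simps)
  qed
  have "\<bar>\<Sum>i\<in>UNIV. (real n - 1) * ln (1 + s i) - n * s i\<bar> \<le> (\<Sum>i\<in>(UNIV::'k set). 2 * m\<^sup>2 + 1)"
    by (intro order_trans[OF sum_abs] sum_mono 1)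
  then have S: "\<bar>\<Sum>i\<in>UNIV. (real n - 1) * ln (1 + s i) - n * s i\<bar> \<le> CARD('k) * (2 * m\<^sup>2 + 1)"
    by (simp only: sum_constant)
  have Qe: "n / 2 * (p * \<epsilon>\<^sup>2) = p * m\<^sup>2 / 2" for p
    unfolding ne[symmetric] by (simp add: algebra_simps)
  have "\<bar>?Q\<bar> \<le> (\<Sum>i\<in>UNIV. \<Sum>j\<in>UNIV. \<bar>P $ i $ j\<bar> * \<epsilon>\<^sup>2)"
  proof (intro order_trans[OF sum_abs] sum_mono)
    fix i j
    have "\<bar>s i\<bar> * (\<bar>s j\<bar> * \<bar>G i j\<bar>) \<le> \<epsilon> * (\<epsilon> * 1)"
      using s G(2) \<epsilon> by (intro mult_mono) auto
    then show "\<bar>P $ i $ j * s i * s j * G i j\<bar> \<le> \<bar>P $ i $ j\<bar> * \<epsilon>\<^sup>2"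
      by (simp add: abs_mult mult.assoc power2_eq_square mult_left_mono)
  qed
  then have "\<bar>n / 2 * ?Q\<bar> \<le> n / 2 * ((\<Sum>i\<in>UNIV. \<Sum>j\<in>UNIV. \<bar>P $ i $ j\<bar>) * \<epsilon>\<^sup>2)"
    by (simp add: abs_mult sum_distrib_right mult_left_mono)
  then have "\<bar>n / 2 * ?Q\<bar> \<le> (\<Sum>i\<in>UNIV. \<Sum>j\<in>UNIV. \<bar>P $ i $ j\<bar>) * m\<^sup>2 / 2"
    unfolding Qe .
  with S have "\<bar>(\<Sum>i\<in>UNIV. (real n - 1) * ln (1 + s i) - n * s i) - n / 2 * ?Q\<bar> \<le>
      CARD('k) * (2 * m\<^sup>2 + 1) + (\<Sum>i\<in>UNIV. \<Sum>j\<in>UNIV. \<bar>P $ i $ j\<bar>) * m\<^sup>2 / 2"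
    by (intro order_trans[OF abs_triangle_ineq4] add_mono)
  then show ?thesis by (simp only: eq[unfolded s_def] s_def)
qed

lemma radial_weight_gram_form:
  fixes P :: "real^'k^'k"
  assumes n: "n > 0" and r: "\<And>i. r i > 0"
  shows "(\<Prod>i\<in>UNIV. radial_weight n (r i)) * ennreal (exp (- (n / 2) * gram_form n P (\<lambda>i. scale_n n (r i) (u i)))) =
    ennreal (2 ^ CARD('k) * exp (radial_exponent n P (\<lambda>i j. inner_n n (u i) (u j)) r)) * ennreal (exp (- (n / 2) * gram_form n P u))"
proof -
  have w: "radial_weight n (r i) = ennreal (2 * exp ((real n - 1) * ln (r i)))" for i
  proof -
    have "r i ^ (n - 1) = exp (real (n - 1) * ln (r i))" using r by (simp add: exp_of_nat_mult)
    then show ?thesis using r n by (simp add: radial_weight_def of_nat_diff)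
  qed
  have "(\<Prod>i\<in>UNIV. radial_weight n (r i)) = ennreal (\<Prod>i\<in>UNIV. 2 * exp ((real n - 1) * ln (r i)))"
    unfolding w by (rule prod_ennreal) simp
  also have "(\<Prod>i\<in>UNIV. 2 * exp ((real n - 1) * ln (r i))) = 2 ^ CARD('k) * exp (\<Sum>i\<in>UNIV. (real n - 1) * ln (r i))"
    by (simp add: prod.distrib exp_sum)
  finally have 1: "(\<Prod>i\<in>UNIV. radial_weight n (r i)) = ennreal (2 ^ CARD('k) * exp (\<Sum>i\<in>UNIV. (real n - 1) * ln (r i)))" .
  have "gram_form n P (\<lambda>i. scale_n n (r i) (u i)) =
     (\<Sum>i\<in>UNIV. \<Sum>j\<in>UNIV. P $ i $ j * (r i * r j - 1) * inner_n n (u i) (u j)) + gram_form n P u"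
    by (simp add: gram_form_def inner_n_scale_n algebra_simps sum.distrib sum_subtractf)
  then have e: "(\<Sum>i\<in>UNIV. (real n - 1) * ln (r i)) + - (n / 2) * gram_form n P (\<lambda>i. scale_n n (r i) (u i)) =
      radial_exponent n P (\<lambda>i j. inner_n n (u i) (u j)) r + - (n / 2) * gram_form n P u"
    by (simp only: radial_exponent_def distrib_left)
  show ?thesis unfolding 1
    by (subst (1 2) ennreal_mult[symmetric]) (simp_all only: mult.assoc exp_add[symmetric] e, simp_all)
qed

subsection \<open>Comparison of the sphere integral with the Gaussian integral\<close>

definition sphere_integral :: "nat \<Rightarrow> real^'k^'k \<Rightarrow> ennreal" where
  "sphere_integral n P = (\<integral>\<^sup>+u. ennreal (exp (- (n / 2) * gram_form n P u)) \<partial>spheres_delta n)"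

text \<open>For \<open>n > 0\<close> this is (2 pi / n)^(kn/2), the integral of exp(- n/2 sum
  |x_i|^2) over all tuples. It is independent of \<open>P\<close> and cancels between \<beta> and 0;
  the determinant form is the one that the change of variables produces.\<close>

definition gauss_const :: "nat \<Rightarrow> 'k::finite itself \<Rightarrow> real" where
  "gauss_const n _ = \<bar>det (mat (1 / sqrt n) :: real^'k^'k)\<bar> ^ n * sqrt (2 * pi) ^ (CARD('k) * n)"

lemma gauss_const_pos: "n > 0 \<Longrightarrow> gauss_const n TYPE('k::finite) > 0"
  by (simp add: gauss_const_def det_diagonal mat_def)

lemma gram_form_measurable [measurable]:
  "(gram_form n P :: ('k::finite \<Rightarrow> nat \<Rightarrow> real) \<Rightarrow> real) \<in> borel_measurable (lebesgue_kn n)"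
  unfolding gram_form_def
  by (intro borel_measurable_sum borel_measurable_times inner_n_measurable borel_measurable_const measurable_component_singleton) auto

lemma sets_spheres_delta [measurable_cong]: "sets (spheres_delta n) = sets (lebesgue_kn n)"
  by (intro sets_PiM_cong refl sets_sphere_delta)

lemma inner_n_mat_act:
  "inner_n n (mat_act n M y i) (mat_act n M y j) = (\<Sum>a\<in>UNIV. \<Sum>b\<in>UNIV. M $ i $ a * M $ j $ b * inner_n n (y a) (y b))"
proof -
  have "inner_n n (mat_act n M y i) (mat_act n M y j) =
      (\<Sum>l<n. \<Sum>a\<in>UNIV. \<Sum>b\<in>UNIV. M $ i $ a * M $ j $ b * (y a l * y b l))"
    by (simp add: inner_n_def mat_act_def sum_product mult_ac)
  also have "\<dots> = (\<Sum>a\<in>UNIV. \<Sum>l<n. \<Sum>b\<in>UNIV. M $ i $ a * M $ j $ b * (y a l * y b l))"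
    by (rule sum.swap)
  also have "\<dots> = (\<Sum>a\<in>UNIV. \<Sum>b\<in>UNIV. \<Sum>l<n. M $ i $ a * M $ j $ b * (y a l * y b l))"
    by (intro sum.cong refl sum.swap)
  finally show ?thesis by (simp add: inner_n_def sum_distrib_left)
qed

lemma mat_mult_left: "(mat c ** L) $ i $ j = c * L $ i $ j" for L :: "real^'m^'n"
  by (simp add: matrix_matrix_mult_def mat_def if_distrib[of "\<lambda>x. x * _"] cong: if_cong)

lemma gauss_density_exp:
  "exp (- (\<Sum>a\<in>UNIV. inner_n n (y a) (y a)) / 2) = sqrt (2 * pi) ^ (CARD('k) * n) * gauss_density n (y :: 'k::finite \<Rightarrow> nat \<Rightarrow> real)"
proof -
  have "gauss_density n y = (\<Prod>i\<in>UNIV. \<Prod>l<n. (1 / sqrt (2 * pi)) * exp (- (y i l * y i l) / 2))"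
    by (simp add: gauss_density_def std_normal_density_def power2_eq_square)
  also have "\<dots> = (1 / sqrt (2 * pi)) ^ (CARD('k) * n) * exp (- (\<Sum>a\<in>UNIV. inner_n n (y a) (y a)) / 2)"
  proof -
    have "(\<Prod>i\<in>(UNIV::'k set). \<Prod>l<n. 1 / sqrt (2 * pi)) = (1 / sqrt (2 * pi)) ^ (CARD('k) * n)"
      by (simp only: prod_constant card_lessThan power_mult[symmetric] mult.commute)
    moreover have "(\<Prod>i\<in>(UNIV::'k set). \<Prod>l<n. exp (- (y i l * y i l) / 2)) = exp (- (\<Sum>a\<in>UNIV. inner_n n (y a) (y a)) / 2)"
      by (simp add: exp_sum[symmetric] inner_n_def sum_negf sum_divide_distrib)
    ultimately show ?thesis by (simp only: prod.distrib)
  qed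
  finally show ?thesis by (simp add: power_divide)
qed

text \<open>The data shared by the two uses: the maximiser with its inverse and a factor, and the
  identity matrix in all three places for \<beta> = 0.\<close>

locale gram_pair =
  fixes P S L :: "real^'k^'k"
  assumes P_sym: "transpose P = P" and PS: "P ** S = mat 1" and S_diag: "\<And>i. S $ i $ i = 1"
    and L: "L ** transpose L = S"
begin

lemma det_L: "det L \<noteq> 0"
proof -
  have "det P * det S = 1" using PS by (metis det_I det_mul)
  moreover have "det S = det L * det L" using L by (metis det_mul det_transpose)
  ultimately show ?thesis by auto
qed

text \<open>This is L^T P L = 1, obtained by turning P L L^T = 1 round, since one-sided inverses of
  square matrices are two-sided.\<close>

lemma whitened: "(\<Sum>i\<in>UNIV. \<Sum>j\<in>UNIV. P $ i $ j * L $ i $ a * L $ j $ b) = (if a = b then 1 else 0)"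
proof -
  have "(P ** L) ** transpose L = mat 1" by (simp add: matrix_mul_assoc[symmetric] L PS)
  then have "transpose L ** (P ** L) = mat 1" using matrix_left_right_inverse by blast
  then have "(transpose L ** (P ** L)) $ a $ b = (if a = b then 1 else 0)" by (simp add: mat_def)
  then show ?thesis
    by (simp add: matrix_matrix_mult_def transpose_def sum_distrib_left mult_ac)
qed

text \<open>The substitution x = L y / sqrt n decouples the vectors, so that in the variable y the
  weight is a standard Gaussian.\<close>

lemma gram_form_whitened:
  assumes "n > 0"
  shows "gram_form n P (mat_act n (mat (1 / sqrt n) ** L) y) = (\<Sum>a\<in>UNIV. inner_n n (y a) (y a)) / n"
proof -
  let ?f = "\<lambda>i j a b. (P $ i $ j * L $ i $ a * L $ j $ b) * (inner_n n (y a) (y b) / n)"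
  have "gram_form n P (mat_act n (mat (1 / sqrt n) ** L) y) =
      (\<Sum>i\<in>UNIV. \<Sum>j\<in>UNIV. \<Sum>a\<in>UNIV. \<Sum>b\<in>UNIV. ?f i j a b)"
    using assms unfolding gram_form_def inner_n_mat_act mat_mult_left
    by (simp only: sum_distrib_right, intro sum.cong refl, simp add: mult_ac)
  \<comment> \<open>The sums over \<open>i\<close> and \<open>j\<close> are brought innermost, where
    \<open>whitened\<close> evaluates them.\<close>
  also have "\<dots> = (\<Sum>i\<in>UNIV. \<Sum>a\<in>UNIV. \<Sum>j\<in>UNIV. \<Sum>b\<in>UNIV. ?f i j a b)"
    by (intro sum.cong refl sum.swap)
  also have "\<dots> = (\<Sum>a\<in>UNIV. \<Sum>i\<in>UNIV. \<Sum>j\<in>UNIV. \<Sum>b\<in>UNIV. ?f i j a b)"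
    by (rule sum.swap)
  also have "\<dots> = (\<Sum>a\<in>UNIV. \<Sum>i\<in>UNIV. \<Sum>b\<in>UNIV. \<Sum>j\<in>UNIV. ?f i j a b)"
    by (intro sum.cong refl sum.swap)
  also have "\<dots> = (\<Sum>a\<in>UNIV. \<Sum>b\<in>UNIV. \<Sum>i\<in>UNIV. \<Sum>j\<in>UNIV. ?f i j a b)"
    by (intro sum.cong refl sum.swap)
  also have "\<dots> = (\<Sum>a\<in>UNIV. \<Sum>b\<in>UNIV. (if a = b then 1 else 0) * (inner_n n (y a) (y b) / n))"
    unfolding sum_distrib_right[symmetric] whitened ..
  also have "\<dots> = (\<Sum>a\<in>UNIV. \<Sum>b\<in>UNIV. if a = b then inner_n n (y a) (y b) / n else 0)"
    by (intro sum.cong refl) simp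
  finally show ?thesis by (simp add: sum_divide_distrib)
qed

text \<open>The test function \<open>g\<close> is carried along for two choices: the constant 1
  gives the total mass, an indicator the mass near \<open>S\<close>.\<close>

lemma nn_integral_gram_form:
  assumes n: "n > 0" and g [measurable]: "g \<in> borel_measurable (lebesgue_kn n)"
  shows "(\<integral>\<^sup>+x. ennreal (exp (- (n / 2) * gram_form n P x)) * g x \<partial>lebesgue_kn n) =
    ennreal (\<bar>det L\<bar> ^ n * gauss_const n TYPE('k)) *
      (\<integral>\<^sup>+y. ennreal (gauss_density n y) * g (mat_act n (mat (1 / sqrt n) ** L) y) \<partial>lebesgue_kn n)"
proof -
  let ?M = "mat (1 / sqrt n) ** L"
  have dM: "det ?M = det (mat (1 / sqrt n) :: real^'k^'k) * det L" by (rule det_mul)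
  have "det (mat (1 / sqrt n) :: real^'k^'k) \<noteq> 0" using n by (simp add: det_diagonal mat_def)
  then have "det ?M \<noteq> 0" using det_L by (simp add: dM)
  then have "(\<integral>\<^sup>+x. ennreal (exp (- (n / 2) * gram_form n P x)) * g x \<partial>lebesgue_kn n) =
    ennreal (\<bar>det ?M\<bar> ^ n) * (\<integral>\<^sup>+y. ennreal (exp (- (n / 2) * gram_form n P (mat_act n ?M y))) * g (mat_act n ?M y) \<partial>lebesgue_kn n)"
    by (rule nn_integral_mat_act) measurable
  also have "(\<integral>\<^sup>+y. ennreal (exp (- (n / 2) * gram_form n P (mat_act n ?M y))) * g (mat_act n ?M y) \<partial>lebesgue_kn n) =
    (\<integral>\<^sup>+y. ennreal (sqrt (2 * pi) ^ (CARD('k) * n)) * (ennreal (gauss_density n y) * g (mat_act n ?M y)) \<partial>lebesgue_kn n)"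
  proof (rule nn_integral_cong)
    fix y
    have "exp (- (n / 2) * gram_form n P (mat_act n ?M y)) = sqrt (2 * pi) ^ (CARD('k) * n) * gauss_density n y"
      using n unfolding gram_form_whitened[OF n] gauss_density_exp[symmetric] by simp
    then show "ennreal (exp (- (n / 2) * gram_form n P (mat_act n ?M y))) * g (mat_act n ?M y) =
        ennreal (sqrt (2 * pi) ^ (CARD('k) * n)) * (ennreal (gauss_density n y) * g (mat_act n ?M y))"
      by (simp only: ennreal_mult gauss_density_nonneg mult.assoc zero_le_power real_sqrt_ge_zero pi_ge_zero mult_nonneg_nonneg zero_le_numeral)
  qed
  also have "\<dots> = ennreal (sqrt (2 * pi) ^ (CARD('k) * n)) * (\<integral>\<^sup>+y. ennreal (gauss_density n y) * g (mat_act n ?M y) \<partial>lebesgue_kn n)"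
  proof (rule nn_integral_cmult)
    have [measurable]: "gauss_density n \<in> borel_measurable (lebesgue_kn n :: ('k \<Rightarrow> nat \<Rightarrow> real) measure)"
      unfolding gauss_density_def
      by (intro borel_measurable_prod measurable_compose[OF measurable_PiM_entry]) auto
    show "(\<lambda>y. ennreal (gauss_density n y) * g (mat_act n ?M y)) \<in> borel_measurable (lebesgue_kn n)" by measurable
  qed
  finally have "(\<integral>\<^sup>+x. ennreal (exp (- (n / 2) * gram_form n P x)) * g x \<partial>lebesgue_kn n) =
    (ennreal (\<bar>det ?M\<bar> ^ n) * ennreal (sqrt (2 * pi) ^ (CARD('k) * n))) *
      (\<integral>\<^sup>+y. ennreal (gauss_density n y) * g (mat_act n ?M y) \<partial>lebesgue_kn n)"
    by (simp only: mult.assoc)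
  moreover have "\<bar>det ?M\<bar> ^ n * sqrt (2 * pi) ^ (CARD('k) * n) = \<bar>det L\<bar> ^ n * gauss_const n TYPE('k)"
    by (simp add: dM gauss_const_def abs_mult power_mult_distrib)
  then have "ennreal (\<bar>det ?M\<bar> ^ n) * ennreal (sqrt (2 * pi) ^ (CARD('k) * n)) = ennreal (\<bar>det L\<bar> ^ n * gauss_const n TYPE('k))"
    by (subst ennreal_mult[symmetric]) auto
  ultimately show ?thesis by (simp only:)
qed

definition laplace_const :: "real \<Rightarrow> real" where
  "laplace_const m = real CARD('k) * (2 * m\<^sup>2 + 1) + (\<Sum>i\<in>UNIV. \<Sum>j\<in>UNIV. \<bar>P $ i $ j\<bar>) * m\<^sup>2 / 2"

text \<open>For each tuple of unit vectors the radial integral is at least its part over a box of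
  volume n^(-k/2), on which the exponent is bounded below. \<open>n \<ge> 4\<close> is the condition
  of \<open>radial_exponent_estimate\<close> for \<open>m = 1\<close>.\<close>

lemma sphere_integral_upper:
  assumes n: "n \<ge> 4"
  shows "ennreal (exp (- laplace_const 1) / sqrt n ^ CARD('k)) * sphere_integral n P \<le> ennreal (\<bar>det L\<bar> ^ n * gauss_const n TYPE('k))"
proof -
  interpret K: product_sigma_finite "\<lambda>_::'k. lborel :: real measure" by (rule product_sigma_finite_lborel)
  have n0: "n > 0" using n by simp
  have sn: "sqrt n \<ge> 2" using n real_sqrt_le_mono[of 4 n] by simp
  let ?E = "\<lambda>x. ennreal (exp (- (n / 2) * gram_form n P x))"
  have "ennreal (exp (- laplace_const 1) / sqrt n ^ CARD('k)) * sphere_integral n P =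
     (\<integral>\<^sup>+u. ennreal (exp (- laplace_const 1) / sqrt n ^ CARD('k)) * ?E u \<partial>spheres_delta n)"
    unfolding sphere_integral_def by (rule nn_integral_cmult[symmetric]) measurable
  also have "\<dots> \<le> (\<integral>\<^sup>+u. (\<integral>\<^sup>+r. (\<Prod>i\<in>UNIV. radial_weight n (r i)) * ?E (\<lambda>i. scale_n n (r i) (u i))
      \<partial>(\<Pi>\<^sub>M i\<in>UNIV. lborel)) \<partial>spheres_delta n)"
  proof (rule nn_integral_mono_AE)
    show "AE u in spheres_delta n. ennreal (exp (- laplace_const 1) / sqrt n ^ CARD('k)) * ?E u \<le>
      (\<integral>\<^sup>+r. (\<Prod>i\<in>UNIV. radial_weight n (r i)) * ?E (\<lambda>i. scale_n n (r i) (u i)) \<partial>(\<Pi>\<^sub>M i\<in>UNIV. lborel))"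
      using AE_spheres_delta_norm
    proof (rule AE_mp, intro AE_I2 impI)
      fix u :: "'k \<Rightarrow> nat \<Rightarrow> real" assume u: "\<forall>i. norm_n n (u i) = 1"
      let ?G = "\<lambda>i j. inner_n n (u i) (u j)"
      let ?b = "\<lambda>i. 1 - (\<Sum>j\<in>UNIV. P $ i $ j * ?G i j)"
      \<comment> \<open>Each side of the box lies above or below 1 according to the sign of the
        first-order coefficient. The box thus depends on the directions, but its volume does
        not.\<close>
      let ?I = "\<lambda>i. if ?b i \<ge> 0 then {1 .. 1 + 1 / sqrt n} else {1 - 1 / sqrt n .. 1}"
      have bd: "?E u * ennreal (exp (- laplace_const 1)) * indicator (PiE UNIV ?I) r \<le>
          (\<Prod>i\<in>UNIV. radial_weight n (r i)) * ?E (\<lambda>i. scale_n n (r i) (u i))" for r :: "'k \<Rightarrow> real"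
      proof (cases "r \<in> PiE UNIV ?I")
        case True
        then have r: "r i \<in> ?I i" for i by (rule PiE_mem) simp
        have r1: "\<bar>r i - 1\<bar> \<le> 1 / sqrt n" for i using r[of i] by (auto split: if_splits)
        have "1 / sqrt n \<le> 1/2" using sn by (intro frac_le) auto
        then have rp: "r i > 0" for i using r1[of i] by linarith
        have sb: "(r i - 1) * ?b i \<ge> 0" for i
          using r[of i] by (cases "?b i \<ge> 0") (auto intro: mult_nonneg_nonneg mult_nonpos_nonpos)
        have "\<bar>radial_exponent n P ?G r - n * (\<Sum>i\<in>UNIV. (r i - 1) * ?b i)\<bar> \<le> laplace_const 1"
          unfolding laplace_const_def using sn r1 u
          by (intro radial_exponent_estimate n0 P_sym) (auto intro: inner_n_commute inner_n_le_1)
        moreover have "0 \<le> n * (\<Sum>i\<in>UNIV. (r i - 1) * ?b i)"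
          by (intro mult_nonneg_nonneg sum_nonneg sb) auto
        ultimately have "- laplace_const 1 \<le> radial_exponent n P ?G r" by linarith
        \<comment> \<open>The factor 2^k of the radial weights is simply bounded below by 1.\<close>
        then have "1 * exp (- laplace_const 1) \<le> 2 ^ CARD('k) * exp (radial_exponent n P ?G r)"
          by (intro mult_mono) auto
        then have "?E u * ennreal (exp (- laplace_const 1)) \<le> ?E u * ennreal (2 ^ CARD('k) * exp (radial_exponent n P ?G r))"
          by (intro mult_left_mono ennreal_leI) simp_all
        moreover have "indicator (PiE UNIV ?I) r = (1 :: ennreal)" using True by (rule indicator_simps)
        ultimately show ?thesis
          unfolding radial_weight_gram_form[OF n0 rp] by (simp only: mult_1_left mult_1_right mult.commute)
      qed simp
      have box: "PiE UNIV ?I \<in> sets (\<Pi>\<^sub>M i\<in>(UNIV::'k set). lborel :: real measure)"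
        by (intro sets_PiM_I_finite) auto
      have "emeasure lborel (?I i) = ennreal (1 / sqrt n)" for i by simp
      then have "emeasure (\<Pi>\<^sub>M i\<in>(UNIV::'k set). lborel) (PiE UNIV ?I) = (\<Prod>i\<in>(UNIV::'k set). ennreal (1 / sqrt n))"
        by (subst K.emeasure_PiM) (auto intro!: prod.cong simp del: emeasure_lborel_Icc_eq)
      also have "\<dots> = ennreal ((1 / sqrt n) ^ CARD('k))" by (simp add: ennreal_power)
      finally have vol: "emeasure (\<Pi>\<^sub>M i\<in>(UNIV::'k set). lborel) (PiE UNIV ?I) = ennreal ((1 / sqrt n) ^ CARD('k))" .
      have "ennreal (exp (- laplace_const 1) / sqrt n ^ CARD('k)) * ?E u =
          ?E u * ennreal (exp (- laplace_const 1)) * ennreal ((1 / sqrt n) ^ CARD('k))"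
        by (simp add: ennreal_mult[symmetric] power_divide mult_ac)
      also have "\<dots> = (\<integral>\<^sup>+r. ?E u * ennreal (exp (- laplace_const 1)) * indicator (PiE UNIV ?I) r \<partial>(\<Pi>\<^sub>M i\<in>UNIV. lborel))"
        by (simp only: nn_integral_cmult_indicator[OF box] vol)
      also have "\<dots> \<le> (\<integral>\<^sup>+r. (\<Prod>i\<in>UNIV. radial_weight n (r i)) * ?E (\<lambda>i. scale_n n (r i) (u i)) \<partial>(\<Pi>\<^sub>M i\<in>UNIV. lborel))"
        by (intro nn_integral_mono bd)
      finally show "ennreal (exp (- laplace_const 1) / sqrt n ^ CARD('k)) * ?E u \<le>
        (\<integral>\<^sup>+r. (\<Prod>i\<in>UNIV. radial_weight n (r i)) * ?E (\<lambda>i. scale_n n (r i) (u i)) \<partial>(\<Pi>\<^sub>M i\<in>UNIV. lborel))" .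
    qed
  qed
  also have "\<dots> = (\<integral>\<^sup>+x. ?E x * 1 \<partial>lebesgue_kn n)"
    by (subst nn_integral_polar_kn[OF n0]) auto
  also have "\<dots> = ennreal (\<bar>det L\<bar> ^ n * gauss_const n TYPE('k))"
    by (subst nn_integral_gram_form[OF n0]) (auto simp: nn_integral_gauss_density)
  finally show ?thesis .
qed

text \<open>The \<open>2 * real CARD('k)\<close> is the Chebyshev threshold, the square comes from
  the two factors \<open>L\<close> in the Gram matrix, and the \<open>+ 1\<close> makes the value
  positive.\<close>

definition deviation :: real where
  "deviation = 2 * real CARD('k) * (\<Sum>a\<in>UNIV. \<Sum>b\<in>UNIV. \<bar>L $ a $ b\<bar>)\<^sup>2 + 1"

lemma deviation_pos: "deviation > 0"
  unfolding deviation_def by (intro add_nonneg_pos mult_nonneg_nonneg) auto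

text \<open>With G_y the Gram matrix of \<open>y\<close>, the difference is the entry of L (G_y / n
  - 1) L^T; absolute row sums of \<open>L\<close> are bounded by the sum over all entries.\<close>

lemma gram_whitened_deviation:
  assumes n: "n > 0"
    and y: "\<And>a b. \<bar>inner_n n (y a) (y b) - real n * (if a = b then 1 else 0)\<bar> \<le> 2 * real CARD('k) * sqrt n"
  shows "\<bar>inner_n n (mat_act n (mat (1 / sqrt n) ** L) y i) (mat_act n (mat (1 / sqrt n) ** L) y j) - S $ i $ j\<bar> \<le> deviation / sqrt n"
proof -
  let ?Z = "\<lambda>a b. inner_n n (y a) (y b) - real n * (if a = b then 1 else 0)"
  let ?l = "\<Sum>a\<in>UNIV. \<Sum>b\<in>UNIV. \<bar>L $ a $ b\<bar>"
  have "S $ i $ j = (\<Sum>a\<in>UNIV. \<Sum>b\<in>UNIV. L $ i $ a * L $ j $ b * (if a = b then 1 else 0))"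
    by (simp add: L[symmetric] matrix_matrix_mult_def transpose_def if_distrib cong: if_cong)
  then have "inner_n n (mat_act n (mat (1 / sqrt n) ** L) y i) (mat_act n (mat (1 / sqrt n) ** L) y j) - S $ i $ j =
      (\<Sum>a\<in>UNIV. \<Sum>b\<in>UNIV. (1 / sqrt n * L $ i $ a) * (1 / sqrt n * L $ j $ b) * inner_n n (y a) (y b)
        - L $ i $ a * L $ j $ b * (if a = b then 1 else 0))"
    by (simp only: inner_n_mat_act mat_mult_left sum_subtractf)
  also have "\<dots> = (\<Sum>a\<in>UNIV. \<Sum>b\<in>UNIV. L $ i $ a * L $ j $ b * ?Z a b / n)"
    using n by (intro sum.cong refl) (simp add: field_simps)
  also have "\<bar>\<dots>\<bar> \<le> (\<Sum>a\<in>UNIV. \<Sum>b\<in>UNIV. \<bar>L $ i $ a\<bar> * \<bar>L $ j $ b\<bar> * (2 * real CARD('k) * sqrt n) / n)"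
  proof (intro order_trans[OF sum_abs] sum_mono)
    fix a b
    have "\<bar>L $ i $ a\<bar> * \<bar>L $ j $ b\<bar> * \<bar>?Z a b\<bar> \<le> \<bar>L $ i $ a\<bar> * \<bar>L $ j $ b\<bar> * (2 * real CARD('k) * sqrt n)"
      by (intro mult_left_mono y) auto
    then show "\<bar>L $ i $ a * L $ j $ b * ?Z a b / n\<bar> \<le> \<bar>L $ i $ a\<bar> * \<bar>L $ j $ b\<bar> * (2 * real CARD('k) * sqrt n) / n"
      unfolding abs_divide abs_mult by (simp only: divide_right_mono of_nat_0_le_iff abs_of_nat)
  qed
  also have "\<dots> = (\<Sum>a\<in>UNIV. \<bar>L $ i $ a\<bar>) * (\<Sum>b\<in>UNIV. \<bar>L $ j $ b\<bar>) * (2 * real CARD('k) / sqrt n)"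
  proof -
    have e: "t * (2 * real CARD('k) * sqrt n) / n = t * (2 * real CARD('k) / sqrt n)" for t
      using n by (simp add: field_simps)
    show ?thesis unfolding e sum_product by (simp only: sum_distrib_right)
  qed
  also have "\<dots> \<le> ?l * ?l * (2 * real CARD('k) / sqrt n)"
  proof -
    have "(\<Sum>a\<in>UNIV. \<bar>L $ i $ a\<bar>) \<le> ?l" for i
      by (rule member_le_sum[of i UNIV "\<lambda>i. \<Sum>a\<in>UNIV. \<bar>L $ i $ a\<bar>"]) (auto intro: sum_nonneg)
    then show ?thesis by (intro mult_right_mono mult_mono) (auto intro: sum_nonneg)
  qed
  also have "\<dots> \<le> deviation / sqrt n"
    using n by (simp add: deviation_def power2_eq_square field_simps)
  finally show ?thesis .
qed

text \<open>Half of the Gaussian mass sits on \<open>?H\<close>. In polar coordinates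
  \<open>?H\<close> confines both the radii and the Gram matrix of the directions, so the exponent
  is bounded above and the radii fill at most a small box.\<close>

lemma sphere_integral_lower:
  assumes n: "2 * deviation \<le> sqrt n"
  shows "ennreal (\<bar>det L\<bar> ^ n * gauss_const n TYPE('k) / 2) \<le>
    ennreal ((4 * deviation / sqrt n) ^ CARD('k) *
      exp (laplace_const deviation + 4 * real CARD('k) * (\<Sum>i\<in>UNIV. \<Sum>j\<in>UNIV. \<bar>P $ i $ j\<bar>) * deviation\<^sup>2)) * sphere_integral n P"
proof -
  interpret K: product_sigma_finite "\<lambda>_::'k. lborel :: real measure" by (rule product_sigma_finite_lborel)
  let ?E = "\<lambda>x. ennreal (exp (- (n / 2) * gram_form n P x))"
  let ?\<epsilon> = "deviation / sqrt n"
  let ?p = "\<Sum>i\<in>UNIV. \<Sum>j\<in>UNIV. \<bar>P $ i $ j\<bar>"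
  let ?K = "laplace_const deviation + 4 * real CARD('k) * ?p * deviation\<^sup>2"
  have n0: "n > 0" using n deviation_pos by (cases n) auto
  have sn: "sqrt n > 0" using n0 by simp
  have e0: "?\<epsilon> > 0" using sn deviation_pos by simp
  have e2: "?\<epsilon> \<le> 1/2" using n sn by (simp add: field_simps)
  have ne: "n * (?\<epsilon> * ?\<epsilon>) = deviation\<^sup>2" using n0 by (simp add: power2_eq_square)
  let ?H = "{x :: 'k \<Rightarrow> nat \<Rightarrow> real. \<forall>i j. \<bar>inner_n n (x i) (x j) - S $ i $ j\<bar> \<le> ?\<epsilon>}"
  have comp [measurable]: "(\<lambda>y. y a) \<in> measurable (lebesgue_kn n :: ('k \<Rightarrow> nat \<Rightarrow> real) measure) (lebesgue_n n)" for a by simp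
  have H [measurable]: "Measurable.pred (lebesgue_kn n) (\<lambda>x. x \<in> ?H)" by measurable
  let ?D = "\<bar>det L\<bar> ^ n * gauss_const n TYPE('k)"
  have D0: "?D \<ge> 0" using gauss_const_pos[OF n0, where 'k='k] by simp
  have "ennreal (?D / 2) = ennreal ?D * ennreal (1/2)"
    using D0 by (subst ennreal_mult[symmetric]) auto
  also have "\<dots> \<le> ennreal ?D * (\<integral>\<^sup>+y. ennreal (gauss_density n y) * indicator ?H (mat_act n (mat (1 / sqrt n) ** L) y) \<partial>lebesgue_kn n)"
  proof -
    let ?good = "{y :: 'k \<Rightarrow> nat \<Rightarrow> real. \<forall>a b. \<bar>inner_n n (y a) (y b) - real n * (if a = b then 1 else 0)\<bar> \<le> 2 * real CARD('k) * sqrt n}"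
    have "indicator ?good y \<le> (indicator ?H (mat_act n (mat (1 / sqrt n) ** L) y) :: ennreal)" for y
      using gram_whitened_deviation[OF n0, of y] by (simp add: indicator_def)
    then have "(\<integral>\<^sup>+y. ennreal (gauss_density n y) * indicator ?good y \<partial>lebesgue_kn n) \<le>
        (\<integral>\<^sup>+y. ennreal (gauss_density n y) * indicator ?H (mat_act n (mat (1 / sqrt n) ** L) y) \<partial>lebesgue_kn n)"
      by (intro nn_integral_mono mult_left_mono) auto
    then show ?thesis
      by (intro mult_left_mono order_trans[OF gauss_covariance_concentration[OF n0]]) auto
  qed
  also have "\<dots> = (\<integral>\<^sup>+x. ?E x * indicator ?H x \<partial>lebesgue_kn n)"
    by (rule nn_integral_gram_form[OF n0, symmetric]) measurable
  also have "\<dots> = (\<integral>\<^sup>+u. (\<integral>\<^sup>+r. (\<Prod>i\<in>UNIV. radial_weight n (r i)) * (?E (\<lambda>i. scale_n n (r i) (u i)) * indicator ?H (\<lambda>i. scale_n n (r i) (u i)))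
      \<partial>(\<Pi>\<^sub>M i\<in>UNIV. lborel)) \<partial>spheres_delta n)"
    by (rule nn_integral_polar_kn[OF n0]) measurable
  also have "\<dots> \<le> (\<integral>\<^sup>+u. ennreal ((4 * deviation / sqrt n) ^ CARD('k) * exp ?K) * ?E u \<partial>spheres_delta n)"
  proof (rule nn_integral_mono_AE)
    let ?box = "PiE UNIV (\<lambda>_::'k. {1 - ?\<epsilon> .. 1 + ?\<epsilon>})"
    have box: "?box \<in> sets (\<Pi>\<^sub>M i\<in>(UNIV::'k set). lborel :: real measure)"
      by (intro sets_PiM_I_finite) auto
    have "emeasure lborel {1 - ?\<epsilon> .. 1 + ?\<epsilon>} = ennreal (2 * ?\<epsilon>)" using e0 by simp
    then have vol: "emeasure (\<Pi>\<^sub>M i\<in>(UNIV::'k set). lborel) ?box = ennreal ((2 * ?\<epsilon>) ^ CARD('k))"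
      using e0 by (subst K.emeasure_PiM) (auto simp: ennreal_power simp del: emeasure_lborel_Icc_eq emeasure_lborel_Icc)
    show "AE u in spheres_delta n. (\<integral>\<^sup>+r. (\<Prod>i\<in>UNIV. radial_weight n (r i)) * (?E (\<lambda>i. scale_n n (r i) (u i)) * indicator ?H (\<lambda>i. scale_n n (r i) (u i)))
      \<partial>(\<Pi>\<^sub>M i\<in>UNIV. lborel)) \<le> ennreal ((4 * deviation / sqrt n) ^ CARD('k) * exp ?K) * ?E u"
      using AE_spheres_delta_norm
    proof (rule AE_mp, intro AE_I2 impI)
      fix u :: "'k \<Rightarrow> nat \<Rightarrow> real" assume u: "\<forall>i. norm_n n (u i) = 1"
      let ?G = "\<lambda>i j. inner_n n (u i) (u j)"
      let ?b = "\<lambda>i. 1 - (\<Sum>j\<in>UNIV. P $ i $ j * ?G i j)"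
      have G1: "\<bar>?G i j\<bar> \<le> 1" for i j using u by (intro inner_n_le_1) auto
      have bd: "(\<Prod>i\<in>UNIV. radial_weight n (r i)) * (?E (\<lambda>i. scale_n n (r i) (u i)) * indicator ?H (\<lambda>i. scale_n n (r i) (u i)))
         \<le> ?E u * ennreal (2 ^ CARD('k) * exp ?K) * indicator ?box r" for r :: "'k \<Rightarrow> real"
      proof (cases "(\<forall>i. r i > 0) \<and> (\<lambda>i. scale_n n (r i) (u i)) \<in> ?H")
        case True
        then have rp: "r i > 0" for i by simp
        have HG: "\<bar>r i * r j * ?G i j - S $ i $ j\<bar> \<le> ?\<epsilon>" for i j
          using True by (simp add: inner_n_scale_n)
        \<comment> \<open>For unit vectors and unit diagonal of \<open>S\<close>, the diagonal
          conditions of \<open>?H\<close> read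
          \<open>\<bar>r i * r i - 1\<bar> \<le> ?\<epsilon>\<close>; dividing by
          \<open>r i + 1 \<ge> 1\<close> bounds the radius.\<close>
        have r1: "\<bar>r i - 1\<bar> \<le> ?\<epsilon>" for i
        proof -
          have "?G i i = 1" using u by (simp add: norm_n_def)
          then have "\<bar>r i * r i - 1\<bar> \<le> ?\<epsilon>" using HG[of i i] by (simp add: S_diag)
          moreover have "r i * r i - 1 = (r i - 1) * (r i + 1)" by (simp add: algebra_simps)
          ultimately have a: "\<bar>r i - 1\<bar> * \<bar>r i + 1\<bar> \<le> ?\<epsilon>" by (simp add: abs_mult)
          have b: "\<bar>r i - 1\<bar> * 1 \<le> \<bar>r i - 1\<bar> * \<bar>r i + 1\<bar>" using rp[of i] by (intro mult_left_mono) auto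
          show ?thesis by (rule order_trans[OF b[unfolded mult_1_right] a])
        qed
        \<comment> \<open>Three of the four \<epsilon> come from replacing \<open>r i * r j\<close>
          by 1, the product of two deviations counting as one by \<epsilon> \<le> 1; the fourth is
          the tolerance in \<open>?H\<close>.\<close>
        have GS: "\<bar>?G i j - S $ i $ j\<bar> \<le> 4 * ?\<epsilon>" for i j
        proof -
          have "r i * r j - 1 = (r i - 1) + (r j - 1) + (r i - 1) * (r j - 1)" by (simp add: algebra_simps)
          moreover have "\<bar>(r i - 1) * (r j - 1)\<bar> \<le> ?\<epsilon> * 1"
            unfolding abs_mult using r1[of i] order_trans[OF r1[of j] e2] e0 by (intro mult_mono) auto
          ultimately have "\<bar>r i * r j - 1\<bar> \<le> 3 * ?\<epsilon>" using r1[of i] r1[of j] by linarith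
          then have "\<bar>r i * r j - 1\<bar> * \<bar>?G i j\<bar> \<le> (3 * ?\<epsilon>) * 1" using G1 e0 by (intro mult_mono) auto
          then have "\<bar>r i * r j * ?G i j - ?G i j\<bar> \<le> 3 * ?\<epsilon>" by (simp add: abs_mult[symmetric] left_diff_distrib)
          then show ?thesis using HG[of i j] by linarith
        qed
        \<comment> \<open>The coefficient vanishes at G = S because the diagonal of P S is 1, so it
          is linear in S - G.\<close>
        have bb: "\<bar>?b i\<bar> \<le> 4 * ?\<epsilon> * ?p" for i
        proof -
          have Ssym: "S $ j $ i = S $ i $ j" for j
          proof -
            have "transpose S = S" by (simp add: L[symmetric] matrix_transpose_mul)
            then show ?thesis by (metis transpose_def vec_lambda_beta)
          qed
          have "(P ** S) $ i $ i = 1" by (simp add: PS mat_def)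
          then have "(\<Sum>j\<in>UNIV. P $ i $ j * S $ i $ j) = 1" by (simp add: matrix_matrix_mult_def Ssym)
          then have "?b i = (\<Sum>j\<in>UNIV. P $ i $ j * (S $ i $ j - ?G i j))"
            by (simp add: right_diff_distrib sum_subtractf)
          also have "\<bar>\<dots>\<bar> \<le> (\<Sum>j\<in>UNIV. \<bar>P $ i $ j\<bar> * (4 * ?\<epsilon>))"
          proof (intro order_trans[OF sum_abs] sum_mono)
            fix j
            have "\<bar>S $ i $ j - ?G i j\<bar> \<le> 4 * ?\<epsilon>" by (subst abs_minus_commute) (rule GS)
            then show "\<bar>P $ i $ j * (S $ i $ j - ?G i j)\<bar> \<le> \<bar>P $ i $ j\<bar> * (4 * ?\<epsilon>)"
              unfolding abs_mult by (intro mult_left_mono) auto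
          qed
          also have "\<dots> = (\<Sum>j\<in>UNIV. \<bar>P $ i $ j\<bar>) * (4 * ?\<epsilon>)" by (simp only: sum_distrib_right)
          also have "\<dots> \<le> ?p * (4 * ?\<epsilon>)"
            using e0 by (intro mult_right_mono member_le_sum[of i UNIV "\<lambda>i. \<Sum>j\<in>UNIV. \<bar>P $ i $ j\<bar>"]) (auto intro: sum_nonneg)
          finally show ?thesis by (simp only: mult_ac)
        qed
        \<comment> \<open>One \<epsilon> comes from the radius and one from the coefficient;
          together they absorb the factor n.\<close>
        have "(\<Sum>i\<in>UNIV. (r i - 1) * ?b i) \<le> (\<Sum>i\<in>(UNIV::'k set). ?\<epsilon> * (4 * ?\<epsilon> * ?p))"
        proof (rule sum_mono)
          fix i
          have "(r i - 1) * ?b i \<le> \<bar>r i - 1\<bar> * \<bar>?b i\<bar>" unfolding abs_mult[symmetric] by simp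
          also have "\<dots> \<le> ?\<epsilon> * (4 * ?\<epsilon> * ?p)" using r1[of i] bb[of i] e0 by (intro mult_mono) auto
          finally show "(r i - 1) * ?b i \<le> ?\<epsilon> * (4 * ?\<epsilon> * ?p)" .
        qed
        then have "n * (\<Sum>i\<in>UNIV. (r i - 1) * ?b i) \<le> n * (real CARD('k) * (?\<epsilon> * (4 * ?\<epsilon> * ?p)))"
          by (intro mult_left_mono) (simp_all only: sum_constant of_nat_0_le_iff)
        also have "\<dots> = 4 * real CARD('k) * ?p * (n * (?\<epsilon> * ?\<epsilon>))" by (simp only: mult_ac)
        finally have 1: "n * (\<Sum>i\<in>UNIV. (r i - 1) * ?b i) \<le> 4 * real CARD('k) * ?p * deviation\<^sup>2" unfolding ne .
        have "\<bar>radial_exponent n P ?G r - n * (\<Sum>i\<in>UNIV. (r i - 1) * ?b i)\<bar> \<le> laplace_const deviation"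
          unfolding laplace_const_def using n r1 G1
          by (intro radial_exponent_estimate n0 P_sym) (auto intro: inner_n_commute)
        then have "radial_exponent n P ?G r \<le> laplace_const deviation + n * (\<Sum>i\<in>UNIV. (r i - 1) * ?b i)"
          by (simp only: abs_le_iff diff_le_eq)
        also have "\<dots> \<le> ?K" by (rule add_left_mono[OF 1])
        finally have "radial_exponent n P ?G r \<le> ?K" .
        then have "?E u * ennreal (2 ^ CARD('k) * exp (radial_exponent n P ?G r)) \<le> ?E u * ennreal (2 ^ CARD('k) * exp ?K)"
          by (intro mult_left_mono ennreal_leI) auto
        moreover have "r \<in> ?box"
        proof (rule PiE_I)
          fix i show "r i \<in> {1 - ?\<epsilon> .. 1 + ?\<epsilon>}" using r1[of i] unfolding atLeastAtMost_iff by linarith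
        qed simp
        then have "indicator ?box r = (1 :: ennreal)" by (rule indicator_simps)
        moreover have "indicator ?H (\<lambda>i. scale_n n (r i) (u i)) = (1 :: ennreal)" using True by (simp add: indicator_def)
        ultimately show ?thesis
          unfolding mult.assoc[symmetric] radial_weight_gram_form[OF n0 rp] by (simp only: mult_1_left mult_1_right mult.commute)
      next
        case False
        then have "\<not> (\<forall>i. r i > 0) \<or> (\<lambda>i. scale_n n (r i) (u i)) \<notin> ?H" by blast
        then have "(\<Prod>i\<in>UNIV. radial_weight n (r i)) = 0 \<or> indicator ?H (\<lambda>i. scale_n n (r i) (u i)) = (0::ennreal)"
        proof
          assume "\<not> (\<forall>i. r i > 0)"
          then obtain i where "\<not> r i > 0" by blast
          then have "radial_weight n (r i) = 0" by (simp add: radial_weight_def)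
          then have "(\<Prod>i\<in>UNIV. radial_weight n (r i)) = 0" by (intro prod_zero) auto
          then show ?thesis by blast
        next
          assume "(\<lambda>i. scale_n n (r i) (u i)) \<notin> ?H"
          then show ?thesis by simp
        qed
        then show ?thesis by (elim disjE) (simp_all only: mult_zero_left mult_zero_right zero_le)
      qed
      have "(\<integral>\<^sup>+r. (\<Prod>i\<in>UNIV. radial_weight n (r i)) * (?E (\<lambda>i. scale_n n (r i) (u i)) * indicator ?H (\<lambda>i. scale_n n (r i) (u i)))
        \<partial>(\<Pi>\<^sub>M i\<in>UNIV. lborel)) \<le> (\<integral>\<^sup>+r. ?E u * ennreal (2 ^ CARD('k) * exp ?K) * indicator ?box r \<partial>(\<Pi>\<^sub>M i\<in>UNIV. lborel))"
        by (intro nn_integral_mono bd)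
      also have "\<dots> = ?E u * ennreal (2 ^ CARD('k) * exp ?K) * ennreal ((2 * ?\<epsilon>) ^ CARD('k))"
        by (simp only: nn_integral_cmult_indicator[OF box] vol)
      also have "\<dots> = ?E u * ennreal (2 ^ CARD('k) * exp ?K * (2 * ?\<epsilon>) ^ CARD('k))"
        using e0 by (subst mult.assoc, subst ennreal_mult[symmetric]) auto
      \<comment> \<open>The 4 combines the 2 of each radial weight with the side
        \<open>2 * ?\<epsilon>\<close> of the box.\<close>
      also have "2 ^ CARD('k) * exp ?K * (2 * ?\<epsilon>) ^ CARD('k) = (4 * deviation / sqrt n) ^ CARD('k) * exp ?K"
      proof -
        have e: "2 ^ CARD('k) * (2 * ?\<epsilon>) ^ CARD('k) = (4 * deviation / sqrt n) ^ CARD('k)"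
          by (simp flip: power_mult_distrib)
        have right_commute: "a * c * b = a * b * c" for a b c :: real
          by (simp only: mult.assoc mult.commute[of b c])
        show ?thesis unfolding e[symmetric] by (rule right_commute)
      qed
      finally show "(\<integral>\<^sup>+r. (\<Prod>i\<in>UNIV. radial_weight n (r i)) * (?E (\<lambda>i. scale_n n (r i) (u i)) * indicator ?H (\<lambda>i. scale_n n (r i) (u i)))
        \<partial>(\<Pi>\<^sub>M i\<in>UNIV. lborel)) \<le> ennreal ((4 * deviation / sqrt n) ^ CARD('k) * exp ?K) * ?E u"
        by (simp only: mult.commute)
    qed
  qed
  also have "\<dots> = ennreal ((4 * deviation / sqrt n) ^ CARD('k) * exp ?K) * sphere_integral n P"
    unfolding sphere_integral_def by (rule nn_integral_cmult) measurable
  finally show ?thesis .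
qed

end

section \<open>Free energy up to a bounded error\<close>

context gram_pair
begin

text \<open>Logarithms of the two comparisons. The factor n^(k/2) is the inverse volume of the
  radial window, of the same order in both, and like \<open>gauss_const\<close> it does not depend
  on \<open>P\<close>.\<close>

lemma sphere_integral_asymp:
  obtains K n0 where "\<And>n. n \<ge> n0 \<Longrightarrow> \<exists>f>0. sphere_integral n P = ennreal f \<and>
    \<bar>ln f - (ln (sqrt n ^ CARD('k) * gauss_const n TYPE('k)) + n * ln \<bar>det L\<bar>)\<bar> \<le> K"
proof -
  \<comment> \<open>The leading 2 pays for keeping only half of the Gaussian mass.\<close>
  define E where "E = 2 * (4 * deviation) ^ CARD('k) * exp (laplace_const deviation + 4 * real CARD('k) * (\<Sum>i\<in>UNIV. \<Sum>j\<in>UNIV. \<bar>P $ i $ j\<bar>) * deviation\<^sup>2)"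
  have E: "E > 0" using deviation_pos by (simp add: E_def)
  \<comment> \<open>Large enough for both comparisons: \<open>2 * deviation \<le> sqrt n\<close> and
    \<open>n \<ge> 4\<close>.\<close>
  define n0 where "n0 = nat \<lceil>(2 * deviation)\<^sup>2\<rceil> + 4"
  have "\<exists>f>0. sphere_integral n P = ennreal f \<and>
    \<bar>ln f - (ln (sqrt n ^ CARD('k) * gauss_const n TYPE('k)) + n * ln \<bar>det L\<bar>)\<bar> \<le> \<bar>laplace_const 1\<bar> + \<bar>ln E\<bar>"
    if n: "n \<ge> n0" for n
  proof -
    have n4: "n \<ge> 4" using n by (simp add: n0_def)
    have "(2 * deviation)\<^sup>2 \<le> real n" using n unfolding n0_def by linarith
    then have dn: "2 * deviation \<le> sqrt n" by (rule real_le_rsqrt)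
    define D where "D = \<bar>det L\<bar> ^ n * gauss_const n TYPE('k)"
    define s where "s = sqrt n ^ CARD('k)"
    have s: "s > 0" using n4 by (simp add: s_def)
    have g: "gauss_const n TYPE('k) > 0" using n4 by (intro gauss_const_pos) simp
    have D: "D > 0" using g det_L by (simp add: D_def)
    have up: "ennreal (exp (- laplace_const 1) / s) * sphere_integral n P \<le> ennreal D"
      unfolding D_def s_def by (rule sphere_integral_upper[OF n4])
    have lo: "ennreal (D / 2) \<le> ennreal (E / 2 / s) * sphere_integral n P"
      using sphere_integral_lower[OF dn] by (simp add: D_def E_def s_def power_divide mult.assoc)
    have "sphere_integral n P \<noteq> top"
      using up s by (auto simp: ennreal_mult_top top_unique)
    then obtain f where f: "sphere_integral n P = ennreal f" "f \<ge> 0" by (cases "sphere_integral n P") auto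
    have up': "exp (- laplace_const 1) / s * f \<le> D"
      using up D s f by (simp add: ennreal_mult[symmetric])
    have lo': "D / 2 \<le> E / 2 / s * f"
      using lo E s f by (simp add: ennreal_mult[symmetric])
    have f0: "f > 0" using lo' D f(2) by (cases "f = 0") auto
    have "f \<le> s * D * exp (laplace_const 1)" using up' s by (simp add: exp_minus field_simps)
    then have "ln f \<le> ln (s * D * exp (laplace_const 1))" using f0 by simp
    then have 1: "ln f \<le> ln s + ln D + laplace_const 1" using s D by (simp add: ln_mult)
    have "s * D / E \<le> f" using lo' s E by (simp add: field_simps)
    then have "ln (s * D / E) \<le> ln f" using s D E f0 by simp
    then have 2: "ln s + ln D - ln E \<le> ln f" using s D E by (simp add: ln_mult ln_div)
    have "ln D = n * ln \<bar>det L\<bar> + ln (gauss_const n TYPE('k))"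
      using g det_L by (simp add: D_def ln_mult ln_realpow)
    then have "ln s + ln D = ln (sqrt n ^ CARD('k) * gauss_const n TYPE('k)) + n * ln \<bar>det L\<bar>"
      using s g unfolding s_def[symmetric] by (subst ln_mult) auto
    with 1 2 f0 f(1) show ?thesis by (intro exI[of _ f]) auto
  qed
  then show ?thesis using that by blast
qed

text \<open>P + 2\<beta>A is diagonal and the Gram matrix has unit diagonal on the spheres, so the
  two exponents differ by a constant. With \<open>P\<close> the identity matrix it also covers
  \<beta> = 0.\<close>

lemma partition_fun_eq:
  assumes PA: "\<And>i j. i \<noteq> j \<Longrightarrow> P $ i $ j = - 2 * \<beta> * A $ i $ j"
    and f: "sphere_integral n P = ennreal f" "f \<ge> 0"
  shows "partition_fun n \<beta> A = exp (n * ((\<Sum>i\<in>UNIV. P $ i $ i + 2 * \<beta> * A $ i $ i) / 2)) * f"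
proof -
  let ?l = "\<Sum>i\<in>UNIV. P $ i $ i + 2 * \<beta> * A $ i $ i"
  let ?h = "\<lambda>x. exp (\<beta> * real n * (\<Sum>i\<in>UNIV. \<Sum>j\<in>UNIV. inner_n n (x i) (x j) * A $ i $ j))"
  have "?h = (\<lambda>x. exp (\<beta> * real n * gram_form n A x))" by (simp add: gram_form_def)
  then have m: "?h \<in> borel_measurable (spheres_delta n :: ('k \<Rightarrow> nat \<Rightarrow> real) measure)"
    by simp measurable
  have eq: "?h u = exp (n * (?l / 2)) * exp (- (n / 2) * gram_form n P u)" if u: "\<forall>i. norm_n n (u i) = 1" for u
  proof -
    have 1: "inner_n n (u i) (u i) = 1" for i using u by (simp add: norm_n_def)
    have "2 * \<beta> * (inner_n n (u i) (u j) * A $ i $ j) = (if i = j then P $ i $ i + 2 * \<beta> * A $ i $ i else 0) - inner_n n (u i) (u j) * P $ i $ j" for i j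
      using PA[of i j] by (cases "i = j") (simp_all add: 1)
    then have "(\<Sum>i\<in>UNIV. \<Sum>j\<in>UNIV. 2 * \<beta> * (inner_n n (u i) (u j) * A $ i $ j)) = ?l - gram_form n P u"
      by (simp add: sum_subtractf gram_form_def)
    then have E: "2 * \<beta> * (\<Sum>i\<in>UNIV. \<Sum>j\<in>UNIV. inner_n n (u i) (u j) * A $ i $ j) = ?l - gram_form n P u"
      by (simp only: sum_distrib_left)
    have "\<beta> * real n * (\<Sum>i\<in>UNIV. \<Sum>j\<in>UNIV. inner_n n (u i) (u j) * A $ i $ j) = n / 2 * (?l - gram_form n P u)"
      unfolding E[symmetric] by simp
    also have "\<dots> = n * (?l / 2) + - (n / 2) * gram_form n P u" by (simp add: right_diff_distrib)
    finally show ?thesis by (simp only: exp_add)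
  qed
  have "partition_fun n \<beta> A = enn2real (\<integral>\<^sup>+u. ennreal (?h u) \<partial>spheres_delta n)"
    unfolding partition_fun_def by (rule integral_eq_nn_integral[OF m]) simp
  also have "(\<integral>\<^sup>+u. ennreal (?h u) \<partial>spheres_delta n) =
      (\<integral>\<^sup>+u. ennreal (exp (n * (?l / 2))) * ennreal (exp (- (n / 2) * gram_form n P u)) \<partial>spheres_delta n)"
  proof (rule nn_integral_cong_AE, rule AE_mp[OF AE_spheres_delta_norm], intro AE_I2 impI)
    fix u :: "'k \<Rightarrow> nat \<Rightarrow> real" assume "\<forall>i. norm_n n (u i) = 1"
    from eq[OF this] show "ennreal (?h u) = ennreal (exp (n * (?l / 2))) * ennreal (exp (- (n / 2) * gram_form n P u))"
      by (simp only: ennreal_mult exp_ge_zero)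
  qed
  also have "\<dots> = ennreal (exp (n * (?l / 2))) * sphere_integral n P"
    unfolding sphere_integral_def by (rule nn_integral_cmult) measurable
  also have "\<dots> = ennreal (exp (n * (?l / 2)) * f)" using f by (simp add: ennreal_mult)
  finally show ?thesis using f by simp
qed

text \<open>Comparing tr(P S) = k with the stationarity equations eliminates the multipliers; the
  term -k will be supplied by the partition function at \<beta> = 0.\<close>

lemma trace_eq:
  assumes PA: "\<And>i j. i \<noteq> j \<Longrightarrow> P $ i $ j = - 2 * \<beta> * A $ i $ j"
  shows "\<beta> * trace (A ** S) = ((\<Sum>i\<in>UNIV. P $ i $ i + 2 * \<beta> * A $ i $ i) - CARD('k)) / 2"
proof -
  have Ssym: "S $ j $ i = S $ i $ j" for i j
  proof -
    have "transpose S = S" by (simp add: L[symmetric] matrix_transpose_mul)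
    then show ?thesis by (metis transpose_def vec_lambda_beta)
  qed
  have "real CARD('k) = trace (P ** S)" by (simp add: PS trace_I)
  also have "\<dots> = (\<Sum>i\<in>UNIV. \<Sum>j\<in>UNIV. P $ i $ j * S $ j $ i)" by (simp add: trace_def matrix_matrix_mult_def)
  also have "\<dots> = (\<Sum>i\<in>UNIV. \<Sum>j\<in>UNIV. (if i = j then P $ i $ i + 2 * \<beta> * A $ i $ i else 0) - 2 * \<beta> * (A $ i $ j * S $ j $ i))"
  proof (intro sum.cong refl)
    fix i j show "P $ i $ j * S $ j $ i = (if i = j then P $ i $ i + 2 * \<beta> * A $ i $ i else 0) - 2 * \<beta> * (A $ i $ j * S $ j $ i)"
      using PA[of i j] S_diag[of i] by (cases "i = j") auto
  qed
  also have "\<dots> = (\<Sum>i\<in>UNIV. P $ i $ i + 2 * \<beta> * A $ i $ i) - 2 * \<beta> * trace (A ** S)"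
    by (simp add: sum_subtractf trace_def matrix_matrix_mult_def sum_distrib_left)
  finally show ?thesis by simp
qed

end

lemma gram_pair_mat_1: "gram_pair (mat 1) (mat 1 :: real^'k^'k) (mat 1)"
  by unfold_locales (auto simp: transpose_mat, simp add: mat_def)

theorem theorem2:
  fixes A :: "real^'k^'k" and \<beta> :: real
  assumes "transpose A = A" and "\<beta> > 0"
  shows "(\<exists>S\<in>feasible. objective \<beta> A S = q_star \<beta> A) \<and>
         (\<exists>C::real. \<forall>n::nat. n > CARD('k) \<longrightarrow>
            \<bar>ereal (free_energy n \<beta> A) - ereal (real n) * q_star \<beta> A\<bar> \<le> ereal C)"
proof -
  obtain S where S: "S \<in> feasible" "det S > 0" and max: "\<And>T. T \<in> feasible \<Longrightarrow> objective \<beta> A T \<le> objective \<beta> A S"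
    using exists_det_pos_maximizer[of \<beta> A] by blast
  have q: "objective \<beta> A S = q_star \<beta> A"
    unfolding q_star_def using S(1) max by (intro antisym SUP_upper SUP_least) auto
  have psd: "psd S" using S by (simp add: feasible_def)
  obtain L :: "real^'k^'k" where L: "L ** transpose L = S" using psd_det_pos_factor[OF psd S(2)] by blast
  have "invertible S" using S(2) by (simp add: invertible_det_nz)
  then obtain P where SP: "S ** P = mat 1" and PS: "P ** S = mat 1" by (auto simp: invertible_def)
  have Psym: "transpose P = P"
  proof -
    have "S ** transpose P = transpose (P ** S)" using psd by (simp add: psd_def matrix_transpose_mul)
    then have "S ** transpose P = mat 1" by (simp add: PS transpose_mat)
    then show ?thesis by (metis PS matrix_mul_assoc matrix_mul_lid matrix_mul_rid)
  qed
  have PA: "P $ i $ j = - 2 * \<beta> * A $ i $ j" if "i \<noteq> j" for i j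
    by (rule maximizer_stationary[OF assms(1) S max SP Psym that])
  interpret G: gram_pair P S L
    using Psym PS L S(1) by unfold_locales (auto simp: feasible_def)
  interpret I: gram_pair "mat 1 :: real^'k^'k" "mat 1" "mat 1" by (rule gram_pair_mat_1)
  let ?l = "\<Sum>i\<in>UNIV. P $ i $ i + 2 * \<beta> * A $ i $ i"
  \<comment> \<open>Half of \<open>ln (det S)\<close> equals \<open>ln \<bar>det L\<bar>\<close>,
    the rate at which the Jacobian grows with \<open>n\<close>.\<close>
  define Q where "Q = \<beta> * trace (A ** S) + ln \<bar>det L\<bar>"
  have "det S = \<bar>det L\<bar> ^ 2" unfolding L[symmetric] by (simp add: det_mul power2_eq_square)
  then have "ln (det S) = 2 * ln \<bar>det L\<bar>" using ln_realpow[of "\<bar>det L\<bar>" 2] G.det_L by (simp only: zero_less_abs_iff of_nat_numeral)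
  then have qQ: "q_star \<beta> A = ereal Q" unfolding q[symmetric] using S(2) by (simp add: objective_def log_det_def Q_def)
  obtain K1 n1 where K1: "\<And>n. n \<ge> n1 \<Longrightarrow> \<exists>f>0. sphere_integral n P = ennreal f \<and>
    \<bar>ln f - (ln (sqrt n ^ CARD('k) * gauss_const n TYPE('k)) + n * ln \<bar>det L\<bar>)\<bar> \<le> K1"
    using G.sphere_integral_asymp by blast
  obtain K2 n2 where K2: "\<And>n. n \<ge> n2 \<Longrightarrow> \<exists>f>0. sphere_integral n (mat 1 :: real^'k^'k) = ennreal f \<and>
    \<bar>ln f - (ln (sqrt n ^ CARD('k) * gauss_const n TYPE('k)) + n * ln \<bar>det (mat 1 :: real^'k^'k)\<bar>)\<bar> \<le> K2"
    using I.sphere_integral_asymp by blast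
  let ?d = "\<lambda>n. \<bar>free_energy n \<beta> A - n * Q\<bar>"
  have big: "?d n \<le> K1 + K2" if n: "n \<ge> max n1 n2" for n
  proof -
    obtain f where f: "f > 0" "sphere_integral n P = ennreal f"
      "\<bar>ln f - (ln (sqrt n ^ CARD('k) * gauss_const n TYPE('k)) + n * ln \<bar>det L\<bar>)\<bar> \<le> K1"
      using K1[of n] n by auto
    obtain g where g: "g > 0" "sphere_integral n (mat 1 :: real^'k^'k) = ennreal g"
      "\<bar>ln g - ln (sqrt n ^ CARD('k) * gauss_const n TYPE('k))\<bar> \<le> K2"
      using K2[of n] n by auto
    have Z: "partition_fun n \<beta> A = exp (n * (?l / 2)) * f"
      using f by (intro G.partition_fun_eq PA) auto
    have "partition_fun n 0 A = exp (n * ((\<Sum>i\<in>(UNIV::'k set). (mat 1 :: real^'k^'k) $ i $ i + 2 * 0 * A $ i $ i) / 2)) * g"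
      using g by (intro I.partition_fun_eq) (auto simp: mat_def)
    then have Z0: "partition_fun n 0 A = exp (n * (CARD('k) / 2)) * g" by (simp add: mat_def)
    have "free_energy n \<beta> A = n * (?l / 2) + ln f - (n * (CARD('k) / 2) + ln g)"
      using f g by (simp add: free_energy_def Z Z0 ln_div ln_mult)
    also have "\<dots> = n * Q + (ln f - (ln (sqrt n ^ CARD('k) * gauss_const n TYPE('k)) + n * ln \<bar>det L\<bar>))
        - (ln g - ln (sqrt n ^ CARD('k) * gauss_const n TYPE('k)))"
      by (simp add: Q_def G.trace_eq[OF PA] field_simps)
    finally show ?thesis using f(3) g(3) by linarith
  qed
  \<comment> \<open>The finitely many dimensions below the threshold are absorbed by adding up their
    errors, each of which is a real number determined by A and \<beta>.\<close>
  have "?d n \<le> (K1 + K2) + (\<Sum>m<max n1 n2. ?d m)" for n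
  proof (cases "n < max n1 n2")
    case True
    have "?d n \<le> (\<Sum>m<max n1 n2. ?d m)" using True by (intro member_le_sum) auto
    moreover have "0 \<le> K1 + K2" using big[of "max n1 n2"] by linarith
    ultimately show ?thesis by linarith
  next
    case False
    have "0 \<le> (\<Sum>m<max n1 n2. ?d m)" by (intro sum_nonneg) auto
    with big[of n] False show ?thesis by linarith
  qed
  then have "\<bar>ereal (free_energy n \<beta> A) - ereal (real n) * q_star \<beta> A\<bar> \<le> ereal ((K1 + K2) + (\<Sum>m<max n1 n2. ?d m))" for n
    by (simp add: qQ)
  with S(1) q show ?thesis by blast
qed

end
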